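(* For even $n\ge 4$ let $\mu_{\min}(n)$ denote the minimum of the algebraic connectivity $\mu(G)$ over all connected cubic (i.e. $3$-regular) simple graphs $G$ on $n$ vertices. Then, as $n\to\infty$ through even integers, $$\mu_{\min}(n)=(1+o(1))\frac{2\pi^2}{n^2}.$$
   Context: All graphs are simple (undirected, without loops or multiple edges) and finite. For a graph $G$ with adjacency matrix $A$ and diagonal degree matrix $D$, the Laplacian matrix is $L(G)=D-A$, and the algebraic connectivity $\mu(G)$ is the second smallest eigenvalue of $L(G)$ (eigenvalues counted with multiplicity). For a regular graph $\mu(G)$ equals the spectral gap, i.e. the difference between the two largest eigenvalues of $A$. *)

theory Defs
  imports
    "Graph_Theory.Pair_Digraph"
    "Graph_Theory.Digraph_Component"
    "Jordan_Normal_Form.Char_Poly"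
    "HOL-Library.Landau_Symbols"
begin

text \<open>
  The locale \<open>pair_graph\<close> of the AFP entry Graph_Theory is the notion of a finite simple graph: a
  finite, symmetric, irreflexive set of arcs given as pairs of vertices, one undirected edge
  \<open>{u, v}\<close> being the two arcs \<open>(u, v)\<close> and \<open>(v, u)\<close>. The degree of a vertex is therefore its
  out-degree. The matrices below presuppose that the vertex set is an initial segment
  \<open>{..<n}\<close> of the natural numbers, so that vertices are row and column indices.
\<close>

definition adjacency_mat :: "nat pair_pre_digraph \<Rightarrow> real mat" where
  "adjacency_mat G = (let n = card (pverts G) in
     mat n n (\<lambda>(i, j). if (i, j) \<in> parcs G then 1 else 0))"

definition degree_mat :: "nat pair_pre_digraph \<Rightarrow> real mat" where
  "degree_mat G = (let n = card (pverts G) in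
     mat n n (\<lambda>(i, j). if i = j then real (out_degree (with_proj G) i) else 0))"

definition laplacian_mat :: "nat pair_pre_digraph \<Rightarrow> real mat" where
  "laplacian_mat G = degree_mat G - adjacency_mat G"

text \<open>
  The eigenvalues in ascending order, repeated according to their multiplicity as roots of the
  characteristic polynomial. For a real symmetric matrix no eigenvalue is lost by taking real
  roots only, and algebraic and geometric multiplicities agree.
\<close>

definition sorted_eigenvalues :: "real mat \<Rightarrow> real list" where
  "sorted_eigenvalues M = sorted_list_of_multiset (proots (char_poly M))"

definition algebraic_connectivity :: "nat pair_pre_digraph \<Rightarrow> real" where
  "algebraic_connectivity G = sorted_eigenvalues (laplacian_mat G) ! 1"

text \<open>
  Every graph on \<open>n\<close> vertices is isomorphic to one with vertex set \<open>{..<n}\<close>. The qualified name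
  selects graph connectedness rather than topological connectedness; it requires a nonempty
  vertex set.
\<close>

definition connected_cubic_graphs :: "nat \<Rightarrow> nat pair_pre_digraph set" where
  "connected_cubic_graphs n = {G. pair_graph G \<and> pverts G = {..<n} \<and>
     Digraph_Component.connected (with_proj G) \<and>
     (\<forall>v \<in> pverts G. out_degree (with_proj G) v = 3)}"

lemma finite_connected_cubic_graphs: "finite (connected_cubic_graphs n)"
proof (rule finite_subset)
  show "connected_cubic_graphs n \<subseteq>
    (\<lambda>E. \<lparr>pverts = {..<n}, parcs = E\<rparr>) ` Pow ({..<n} \<times> {..<n})"
  proof
    fix G :: "nat pair_pre_digraph"
    assume G: "G \<in> connected_cubic_graphs n"
    then interpret pair_graph G by (simp add: connected_cubic_graphs_def)
    have V: "pverts G = {..<n}" using G by (simp add: connected_cubic_graphs_def)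
    show "G \<in> (\<lambda>E. \<lparr>pverts = {..<n}, parcs = E\<rparr>) ` Pow ({..<n} \<times> {..<n})"
    proof (rule image_eqI)
      show "G = \<lparr>pverts = {..<n}, parcs = parcs G\<rparr>"
        unfolding V[symmetric] by simp
      show "parcs G \<in> Pow ({..<n} \<times> {..<n})"
        unfolding V[symmetric] by (auto intro: in_arcsD1 in_arcsD2)
    qed
  qed
qed simp

text \<open>
  Meaningful for even \<open>n \<ge> 4\<close>; for all other \<open>n\<close> there is no cubic graph on \<open>n\<close> vertices (apart
  from the null graph, which is not connected) and the value is unspecified.
\<close>

definition mu_min :: "nat \<Rightarrow> real" where
  "mu_min n = Min (algebraic_connectivity ` connected_cubic_graphs n)"

end

(*
  Upper bound: in a chain of copies of K4 minus an edge joined by bridges, each block and each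
  bridge has effective resistance 1, so four vertices contribute resistance 2; transplanting the
  first nonconstant eigenvector of a path gives a test vector with Rayleigh quotient 2 pi^2 / n^2.

  Lower bound: no cubic graph is worse. Sort the vertices by an eigenvector f of mu. The number of
  edges across the k-th cut is at least 1 and has the parity of k, and simplicity and 3-regularity
  forbid too many bridges close together; hence the sorted order splits into segments of length 2,
  4 or 6 across each of which the effective resistance is at most 1/2 per vertex.
  Linear interpolation of f along the segments reduces the claim to the Poincare inequality of a
  path with the sharp constant 2 - 2 cos(pi / n), up to an error of relative order 1 / n.
*)

theory Submission
  imports Defs "HOL-Analysis.Function_Topology" "HOL-Analysis.L2_Norm" "HOL-Analysis.Convex"
    "HOL-Real_Asymp.Real_Asymp"
begin

section \<open>Rayleigh quotients of the Laplacian\<close>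

text \<open>\<open>algebraic_connectivity\<close> is an entry in a sorted list of roots. Two facts
  tie it to Rayleigh quotients: 0 is a simple root (\<open>order_zero\<close>), and the energy has a
  minimiser among mean-zero functions of norm 1, by compactness, which is an eigenvector. The
  obstacle in the lower bound is that cut sizes alone are too weak: parity and connectedness allow
  the sizes 1, 2, 1, 2, ..., that is resistance 3/4 per vertex, which would give the constant 4/3 in
  place of 2. Only degree counts inside short blocks recover 1/2 per vertex. The relative error 1 /
  n has one source: in norm, \<open>f\<close> and its interpolation differ by at most 8 times the
  root of the energy, while the Poincare inequality of the path bounds the norm by a multiple of
  order n of that root.\<close>

lemma out_degree_with_proj: "out_degree (with_proj G) i = card {v. (i, v) \<in> parcs G}"
proof -
  have "out_arcs (with_proj G) i = Pair i ` {v. (i, v) \<in> parcs G}"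
    by (auto simp: out_arcs_def)
  then show ?thesis
    by (simp add: out_degree_def card_image inj_on_def)
qed

text \<open>An edge is two arcs, hence the division by 2. The polarised form serves the first
  variation in \<open>rayleigh_minimizer_eigen\<close>.\<close>

definition dirichlet :: "nat pair_pre_digraph \<Rightarrow> (nat \<Rightarrow> real) \<Rightarrow> (nat \<Rightarrow> real) \<Rightarrow> real" where
  "dirichlet G f g = (\<Sum>(u, v)\<in>parcs G. (f u - f v) * (g u - g v)) / 2"

text \<open>The Laplacian matrix acting on functions instead of vectors
  (\<open>laplacian_mat_mult\<close>); only values below \<open>n\<close> matter
  (\<open>laplacian_cong\<close>).\<close>

definition laplacian :: "nat pair_pre_digraph \<Rightarrow> (nat \<Rightarrow> real) \<Rightarrow> nat \<Rightarrow> real" where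
  "laplacian G f u = (\<Sum>v | (u, v) \<in> parcs G. f u - f v)"

locale connected_graph_on =
  fixes G :: "nat pair_pre_digraph" and n :: nat
  assumes graph: "pair_graph G"
    and verts: "pverts G = {..<n}"
    and conn: "Digraph_Component.connected (with_proj G)"
begin

lemma arcs_less: "(u, v) \<in> parcs G \<Longrightarrow> u < n \<and> v < n"
  and arcs_sym: "(u, v) \<in> parcs G \<Longrightarrow> (v, u) \<in> parcs G"
  and no_loop: "(u, u) \<notin> parcs G"
  and fin_arcs: "finite (parcs G)"
proof -
  interpret pair_graph G by (rule graph)
  show "(u, v) \<in> parcs G \<Longrightarrow> u < n \<and> v < n"
    using in_arcsD1 in_arcsD2 verts by blast
  show "(u, v) \<in> parcs G \<Longrightarrow> (v, u) \<in> parcs G"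
    using pair_sym_arcs by (auto simp: symmetric_def sym_def)
  show "(u, u) \<notin> parcs G"
    using pair_no_loops by fastforce
  show "finite (parcs G)"
    by (rule pair_finite_arcs)
qed

lemma n_pos: "n > 0"
  using conn verts by (auto simp: connected_conv)

text \<open>Apart from \<open>n > 0\<close>, connectedness is used only in this form: for level sets
  of a function of energy 0, and for initial segments of the sorted vertices.\<close>

lemma closed_set_all:
  assumes u: "u \<in> A" "u < n" and closed: "\<And>x y. x \<in> A \<Longrightarrow> (x, y) \<in> parcs G \<Longrightarrow> y \<in> A"
    and v: "v < n"
  shows "v \<in> A"
proof -
  have "(u, v) \<in> rtrancl_on {..<n} ((parcs G)\<^sup>s)"
    using conn u v verts by (auto simp: connected_conv)
  then show ?thesis
  proof (induction rule: rtrancl_on_induct)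
    case base
    then show ?case using u by simp
  next
    case (step y z)
    then have "(y, z) \<in> parcs G"
      using arcs_sym by (auto simp: symcl_def)
    then show ?case using closed step by blast
  qed
qed

lemma sum_arcs_swap: "(\<Sum>(u, v)\<in>parcs G. h u v) = (\<Sum>(u, v)\<in>parcs G. h v u)"
  for h :: "nat \<Rightarrow> nat \<Rightarrow> 'c :: comm_monoid_add"
  by (rule sum.reindex_bij_witness[where i = prod.swap and j = prod.swap]) (auto intro: arcs_sym)

lemma sum_arcs: "(\<Sum>(u, v)\<in>parcs G. h u v) = (\<Sum>u<n. \<Sum>v | (u, v) \<in> parcs G. h u v)"
  for h :: "nat \<Rightarrow> nat \<Rightarrow> 'c :: comm_monoid_add"
proof -
  have eq: "parcs G = (SIGMA u:{..<n}. {v. (u, v) \<in> parcs G})"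
    using arcs_less by auto
  have fin: "finite {v. (u, v) \<in> parcs G}" for u
    by (rule finite_subset[of _ "{..<n}"]) (use arcs_less in auto)
  have "(\<Sum>(u, v)\<in>(SIGMA u:{..<n}. {v. (u, v) \<in> parcs G}). h u v) =
      (\<Sum>u<n. \<Sum>v | (u, v) \<in> parcs G. h u v)"
    by (rule sum.Sigma[symmetric]) (use fin in auto)
  then show ?thesis by (simp only: eq[symmetric])
qed

text \<open>Discrete Green identity: averaging the arc sum with its reversal turns
  \<open>g u\<close> into \<open>g u - g v\<close>.\<close>

lemma sum_laplacian: "(\<Sum>u<n. g u * laplacian G f u) = dirichlet G g f"
proof -
  have "(\<Sum>u<n. g u * laplacian G f u) = (\<Sum>(u, v)\<in>parcs G. g u * (f u - f v))"
    by (simp add: sum_arcs laplacian_def sum_distrib_left)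
  moreover from this have "(\<Sum>u<n. g u * laplacian G f u) = (\<Sum>(u, v)\<in>parcs G. g v * (f v - f u))"
    by (simp add: sum_arcs_swap[of "\<lambda>u v. g u * (f u - f v)"])
  ultimately have "2 * (\<Sum>u<n. g u * laplacian G f u) =
      (\<Sum>(u, v)\<in>parcs G. g u * (f u - f v)) + (\<Sum>(u, v)\<in>parcs G. g v * (f v - f u))"
    by simp
  also have "\<dots> = (\<Sum>(u, v)\<in>parcs G. (g u - g v) * (f u - f v))"
    unfolding sum.distrib[symmetric] by (rule sum.cong) (auto simp: algebra_simps)
  finally show ?thesis by (simp add: dirichlet_def)
qed

lemma dirichlet_nonneg: "dirichlet G f f \<ge> 0"
  by (auto simp: dirichlet_def intro!: sum_nonneg)

lemma dirichlet_cong: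
  assumes "\<And>i. i < n \<Longrightarrow> f i = f' i" "\<And>i. i < n \<Longrightarrow> g i = g' i"
  shows "dirichlet G f g = dirichlet G f' g'"
  unfolding dirichlet_def using assms arcs_less by (auto intro!: sum.cong)

lemma laplacian_cong:
  assumes "\<And>i. i < n \<Longrightarrow> f i = f' i" "u < n"
  shows "laplacian G f u = laplacian G f' u"
  unfolding laplacian_def using assms arcs_less by (auto intro!: sum.cong)

lemma sum_laplacian_zero: "(\<Sum>u<n. laplacian G f u) = 0"
  using sum_laplacian[of "\<lambda>_. 1" f] by (simp add: dirichlet_def)

lemma dirichlet_zero_const:
  assumes "dirichlet G f f = 0" "u < n" "v < n"
  shows "f v = f u"
proof -
  have "(\<Sum>e\<in>parcs G. case e of (u, v) \<Rightarrow> (f u - f v) * (f u - f v)) = 0"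
    using assms(1) by (simp add: dirichlet_def)
  then have "\<forall>e\<in>parcs G. (case e of (u, v) \<Rightarrow> (f u - f v) * (f u - f v)) = 0"
    by (subst (asm) sum_nonneg_eq_0_iff) (auto simp: fin_arcs)
  then have eq: "f x = f y" if "(x, y) \<in> parcs G" for x y
    using that by fastforce
  show ?thesis
    using closed_set_all[of u "{x. f x = f u}" v] eq assms by auto
qed

section \<open>The Laplacian matrix and the roots of its characteristic polynomial\<close>

lemma laplacian_mat_carrier: "laplacian_mat G \<in> carrier_mat n n"
  unfolding laplacian_mat_def degree_mat_def adjacency_mat_def verts Let_def
  by (intro minus_carrier_mat) simp

lemma laplacian_mat_index:
  assumes "i < n" "j < n"
  shows "laplacian_mat G $$ (i, j) =
    (if i = j then real (card {v. (i, v) \<in> parcs G}) else 0) - (if (i, j) \<in> parcs G then 1 else 0)"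
proof -
  have "out_arcs (with_proj G) i = Pair i ` {v. (i, v) \<in> parcs G}"
    by (auto simp: out_arcs_def)
  then have "out_degree (with_proj G) i = card {v. (i, v) \<in> parcs G}"
    by (simp add: out_degree_def card_image inj_on_def)
  then show ?thesis
    using assms by (auto simp: laplacian_mat_def degree_mat_def adjacency_mat_def verts Let_def)
qed

lemma laplacian_mat_row_sum:
  assumes "i < n"
  shows "(\<Sum>j<n. laplacian_mat G $$ (i, j) * f j) = laplacian G f i"
proof -
  have fin: "finite {v. (i, v) \<in> parcs G}"
    by (rule finite_subset[of _ "{..<n}"]) (use arcs_less in auto)
  have sub: "{..<n} \<inter> {v. (i, v) \<in> parcs G} = {v. (i, v) \<in> parcs G}"
    using arcs_less by auto
  have "(\<Sum>j<n. laplacian_mat G $$ (i, j) * f j) =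
      (\<Sum>j<n. (if i = j then real (card {v. (i, v) \<in> parcs G}) * f j else 0)
         - (if j \<in> {v. (i, v) \<in> parcs G} then f j else 0))"
    by (rule sum.cong) (auto simp: laplacian_mat_index assms algebra_simps)
  also have "\<dots> = real (card {v. (i, v) \<in> parcs G}) * f i - sum f {v. (i, v) \<in> parcs G}"
    using assms sum.inter_restrict[of "{..<n}" f "{v. (i, v) \<in> parcs G}"]
    by (simp add: sum_subtractf sub del: mem_Collect_eq)
  also have "\<dots> = laplacian G f i"
    by (simp add: laplacian_def sum_subtractf)
  finally show ?thesis .
qed

lemma laplacian_mat_mult:
  assumes "v \<in> carrier_vec n"
  shows "laplacian_mat G *\<^sub>v v = vec n (laplacian G (($) v))"
proof (rule eq_vecI)
  fix i assume "i < dim_vec (vec n (laplacian G (($) v)))"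
  then have i: "i < n" by simp
  have "(laplacian_mat G *\<^sub>v v) $ i = (\<Sum>j = 0..<n. laplacian_mat G $$ (i, j) * v $ j)"
    using i assms laplacian_mat_carrier by (simp add: scalar_prod_def)
  then show "(laplacian_mat G *\<^sub>v v) $ i = vec n (laplacian G (($) v)) $ i"
    using i laplacian_mat_row_sum[OF i, of "($) v"] by (simp add: lessThan_atLeast0)
qed (use laplacian_mat_carrier in auto)

lemma eigenvalue_laplacian_iff:
  "eigenvalue (laplacian_mat G) k \<longleftrightarrow>
    (\<exists>f. (\<exists>i<n. f i \<noteq> 0) \<and> (\<forall>i<n. laplacian G f i = k * f i))"
proof
  assume "eigenvalue (laplacian_mat G) k"
  then obtain v where v: "v \<in> carrier_vec n" "v \<noteq> 0\<^sub>v n" "laplacian_mat G *\<^sub>v v = k \<cdot>\<^sub>v v"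
    using laplacian_mat_carrier by (auto simp: eigenvalue_def eigenvector_def)
  have "\<exists>i<n. v $ i \<noteq> 0"
    using v by (metis eq_vecI carrier_vecD index_zero_vec)
  moreover have "laplacian G (($) v) i = k * v $ i" if "i < n" for i
    using arg_cong[OF v(3), of "\<lambda>w. w $ i"] v(1) that by (simp add: laplacian_mat_mult)
  ultimately show "\<exists>f. (\<exists>i<n. f i \<noteq> 0) \<and> (\<forall>i<n. laplacian G f i = k * f i)"
    by blast
next
  assume "\<exists>f. (\<exists>i<n. f i \<noteq> 0) \<and> (\<forall>i<n. laplacian G f i = k * f i)"
  then obtain f i where f: "i < n" "f i \<noteq> 0" "\<And>i. i < n \<Longrightarrow> laplacian G f i = k * f i"
    by auto
  have "laplacian_mat G *\<^sub>v vec n f = k \<cdot>\<^sub>v vec n f"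
  proof (rule eq_vecI)
    fix i assume "i < dim_vec (k \<cdot>\<^sub>v vec n f)"
    then have i: "i < n" by simp
    have "laplacian G (($) (vec n f)) i = laplacian G f i"
      using i by (intro laplacian_cong) auto
    then show "(laplacian_mat G *\<^sub>v vec n f) $ i = (k \<cdot>\<^sub>v vec n f) $ i"
      using i f(3) by (simp add: laplacian_mat_mult)
  qed (use laplacian_mat_carrier in auto)
  moreover have "vec n f \<noteq> 0\<^sub>v n"
    using f by (metis index_vec index_zero_vec(1))
  ultimately show "eigenvalue (laplacian_mat G) k"
    using laplacian_mat_carrier unfolding eigenvalue_def eigenvector_def
    by (intro exI[of _ "vec n f"]) simp
qed

lemma char_poly_nz: "char_poly (laplacian_mat G) \<noteq> 0"
  using degree_monic_char_poly[OF laplacian_mat_carrier] by auto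

lemma in_proots_iff:
  "k \<in># proots (char_poly (laplacian_mat G)) \<longleftrightarrow>
    (\<exists>f. (\<exists>i<n. f i \<noteq> 0) \<and> (\<forall>i<n. laplacian G f i = k * f i))"
  using char_poly_nz eigenvalue_root_char_poly[OF laplacian_mat_carrier, of k]
  by (simp add: eigenvalue_laplacian_iff)

lemma zero_in_proots: "0 \<in># proots (char_poly (laplacian_mat G))"
  unfolding in_proots_iff using n_pos
  by (intro exI[of _ "\<lambda>_. 1"]) (auto simp: laplacian_def)

lemma sum_sq_pos:
  assumes "i < n" "f i \<noteq> (0::real)"
  shows "(\<Sum>i<n. (f i)\<^sup>2) > 0"
  using assms by (intro sum_pos2[of _ i]) auto

lemma dirichlet_eigen:
  assumes "\<forall>i<n. laplacian G f i = k * f i"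
  shows "dirichlet G f f = k * (\<Sum>i<n. (f i)\<^sup>2)"
  unfolding sum_laplacian[symmetric]
  by (simp add: assms sum_distrib_left power2_eq_square algebra_simps)

lemma proots_nonneg:
  assumes "k \<in># proots (char_poly (laplacian_mat G))"
  shows "k \<ge> 0"
proof -
  obtain f i where f: "i < n" "f i \<noteq> 0" "\<forall>i<n. laplacian G f i = k * f i"
    using assms in_proots_iff by auto
  then show ?thesis
    using dirichlet_eigen[OF f(3)] dirichlet_nonneg[of f] sum_sq_pos[of i f]
    by (metis mult_less_0_iff not_le)
qed

text \<open>Adding all columns of \<open>x I - L\<close> to the first one makes that column constantly \<open>x\<close>; the
  cofactor that remains does not vanish at 0.\<close>

lemma order_zero: "order 0 (char_poly (laplacian_mat G)) \<le> 1"
proof -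
  let ?L = "laplacian_mat G"
  \<comment> \<open>Multiplying by \<open>U\<close> on the right adds all columns to column 0, and
    \<open>D\<close> scales column 0 by the variable. Both are triangular, so
    \<open>char_poly_matrix ?L * U = C * D\<close> splits off one factor x.\<close>
  define U :: "real poly mat" where "U = mat n n (\<lambda>(i, j). if i = j \<or> j = 0 then 1 else 0)"
  define D :: "real poly mat" where "D = mat n n (\<lambda>(i, j). if i = j then (if j = 0 then [:0, 1:] else 1) else 0)"
  define C where "C = mat n n (\<lambda>(i, j). if j = 0 then 1 else char_poly_matrix ?L $$ (i, j))"
  define C0 where "C0 = mat n n (\<lambda>(i, j). if j = 0 then 1 else - (?L $$ (i, j)))"
  note car = laplacian_mat_carrier
  have cU: "U \<in> carrier_mat n n" and cD: "D \<in> carrier_mat n n" and cC: "C \<in> carrier_mat n n"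
    and cC0: "C0 \<in> carrier_mat n n"
    by (auto simp: U_def D_def C_def C0_def)
  have cP: "char_poly_matrix ?L \<in> carrier_mat n n"
    using car by simp
  have cpm: "char_poly_matrix ?L $$ (i, j) = (if i = j then [:0, 1:] else 0) - [:?L $$ (i, j):]"
    if "i < n" "j < n" for i j
    using that car by (simp add: char_poly_matrix_def)
  have split0: "(\<Sum>k = 0..<n. h k) = h 0 + (\<Sum>k\<in>{0..<n} - {0}. h k)" for h :: "nat \<Rightarrow> real poly"
    using n_pos by (intro sum.remove) auto
  have prod_eq: "char_poly_matrix ?L * U = C * D"
  proof (rule eq_matI)
    fix i j assume "i < dim_row (C * D)" "j < dim_col (C * D)"
    then have ij: "i < n" "j < n" using cC cD by auto
    have lhs: "(char_poly_matrix ?L * U) $$ (i, j) = (\<Sum>k = 0..<n. char_poly_matrix ?L $$ (i, k) * U $$ (k, j))"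
      using ij cP cU by (simp add: scalar_prod_def)
    have rhs: "(C * D) $$ (i, j) = (\<Sum>k = 0..<n. C $$ (i, k) * D $$ (k, j))"
      using ij cC cD by (simp add: scalar_prod_def)
    show "(char_poly_matrix ?L * U) $$ (i, j) = (C * D) $$ (i, j)"
    proof (cases "j = 0")
      case True
      have rs: "(\<Sum>k<n. ?L $$ (i, k)) = 0"
        using laplacian_mat_row_sum[OF ij(1), of "\<lambda>_. 1"] by (simp add: laplacian_def)
      have "(\<Sum>k = 0..<n. char_poly_matrix ?L $$ (i, k) * U $$ (k, j)) =
          (\<Sum>k = 0..<n. (if i = k then [:0, 1:] else 0) - [:?L $$ (i, k):])"
        using ij True by (intro sum.cong) (auto simp: cpm U_def)
      also have "\<dots> = [:0, 1:] - (\<Sum>k<n. [:?L $$ (i, k):])"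
        using ij by (simp add: sum_subtractf lessThan_atLeast0)
      also have "(\<Sum>k<n. [:?L $$ (i, k):]) = [:\<Sum>k<n. ?L $$ (i, k):]"
        by (induction n) auto
      finally have l: "(char_poly_matrix ?L * U) $$ (i, j) = [:0, 1:]"
        by (simp add: lhs rs)
      have "(\<Sum>k = 0..<n. C $$ (i, k) * D $$ (k, j)) = [:0, 1:]"
        using ij True by (subst split0) (auto simp: C_def D_def intro!: sum.neutral)
      then show ?thesis by (simp add: l rhs)
    next
      case False
      have "(\<Sum>k = 0..<n. char_poly_matrix ?L $$ (i, k) * U $$ (k, j)) =
          (\<Sum>k = 0..<n. C $$ (i, k) * D $$ (k, j))"
        using ij False by (intro sum.cong) (auto simp: C_def D_def U_def)
      then show ?thesis by (simp add: lhs rhs)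
    qed
  qed (use cP cU cC cD in auto)
  have detU: "det U = 1"
  proof -
    have "det U = prod_list (diag_mat U)"
      by (rule det_lower_triangular[OF _ cU]) (simp add: U_def)
    also have "\<dots> = (\<Prod>i = 0..<n. U $$ (i, i))"
      using cU by (simp add: prod_list_diag_prod)
    also have "\<dots> = 1"
      by (intro prod.neutral) (simp add: U_def)
    finally show ?thesis .
  qed
  have detD: "det D = [:0, 1:]"
  proof -
    have "det D = prod_list (diag_mat D)"
      by (rule det_upper_triangular[OF _ cD]) (auto simp: D_def)
    also have "\<dots> = (\<Prod>i = 0..<n. D $$ (i, i))"
      using cD by (simp add: prod_list_diag_prod)
    also have "\<dots> = (\<Prod>i = 0..<n. if i = 0 then [:0, 1:] else 1)"
      by (intro prod.cong) (auto simp: D_def)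
    also have "\<dots> = [:0, 1:]" using n_pos by simp
    finally show ?thesis .
  qed
  have fact: "char_poly ?L = det C * [:0, 1:]"
    using arg_cong[OF prod_eq, of det] cP cU cC cD
    by (simp add: det_mult[of _ n] detU detD char_poly_def)
  have "poly (det C) 0 = det C0"
    by (rule poly_det_cong[OF cC0 cC]) (auto simp: C_def C0_def cpm)
  moreover have "det C0 \<noteq> 0"
  proof
    assume "det C0 = 0"
    then obtain v where v: "v \<in> carrier_vec n" "v \<noteq> 0\<^sub>v n" "C0 *\<^sub>v v = 0\<^sub>v n"
      using det_0_iff_vec_prod_zero[OF cC0] by auto
    \<comment> \<open>With entry 0 erased, the kernel equation says that
      \<open>laplacian G f\<close> is constantly \<open>v $ 0\<close>. A Laplacian sums to 0, so the
      constant is 0; then \<open>f\<close> has energy 0 and equals its value 0 at vertex 0.\<close>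
    define f where "f = (\<lambda>i. if i = 0 then 0 else v $ i)"
    have eq: "v $ 0 = laplacian G f i" if i: "i < n" for i
    proof -
      have "0 = (C0 *\<^sub>v v) $ i" unfolding v(3) using i by simp
      also have "\<dots> = (\<Sum>k = 0..<n. C0 $$ (i, k) * v $ k)"
        using cC0 v(1) i by (simp add: scalar_prod_def)
      also have "\<dots> = (\<Sum>k = 0..<n. (if k = 0 then v $ 0 else 0) - ?L $$ (i, k) * f k)"
        using i by (intro sum.cong) (auto simp: C0_def f_def)
      also have "\<dots> = v $ 0 - laplacian G f i"
        using n_pos laplacian_mat_row_sum[OF i, of f] by (simp add: sum_subtractf lessThan_atLeast0)
      finally show ?thesis by simp
    qed
    have "(\<Sum>i<n. laplacian G f i) = n * v $ 0"
      using eq by (simp flip: eq)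
    then have v0: "v $ 0 = 0" using sum_laplacian_zero n_pos by simp
    have "dirichlet G f f = 0"
      using eq v0 by (simp flip: sum_laplacian)
    then have f0: "f i = 0" if "i < n" for i
      using dirichlet_zero_const[of f 0 i] n_pos that by (simp add: f_def)
    have "v $ i = 0" if "i < n" for i
      using f0[OF that] v0 by (cases "i = 0") (auto simp: f_def)
    then have "v = 0\<^sub>v n" using v(1) by (intro eq_vecI) auto
    then show False using v by simp
  qed
  ultimately have "order 0 (det C) = 0"
    by (intro order_0I) simp
  moreover have "order 0 (char_poly ?L) = order 0 (det C) + order 0 [:0, 1 :: real:]"
    using char_poly_nz unfolding fact by (intro order_mult) auto
  moreover have "order 0 [:0, 1 :: real:] \<le> 1"
    using order_degree[of "[:0, 1 :: real:]" 0] by simp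
  ultimately show ?thesis by simp
qed

section \<open>Variational description of the second eigenvalue\<close>

lemma dirichlet_add_scaled:
  "dirichlet G (\<lambda>i. f i + t * g i) (\<lambda>i. f i + t * g i) =
    dirichlet G f f + 2 * t * dirichlet G g f + t\<^sup>2 * dirichlet G g g"
proof -
  have "(\<Sum>(u, v)\<in>parcs G. (f u + t * g u - (f v + t * g v)) * (f u + t * g u - (f v + t * g v))) =
    (\<Sum>(u, v)\<in>parcs G. (f u - f v) * (f u - f v)) + 2 * t * (\<Sum>(u, v)\<in>parcs G. (g u - g v) * (f u - f v))
     + t\<^sup>2 * (\<Sum>(u, v)\<in>parcs G. (g u - g v) * (g u - g v))"
    unfolding sum_distrib_left sum.distrib[symmetric]
    by (rule sum.cong) (auto simp: algebra_simps power2_eq_square)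
  then show ?thesis
    by (simp add: dirichlet_def add_divide_distrib)
qed

text \<open>Compactness takes the place of the spectral theorem; the inequality for all mean-zero
  \<open>g\<close> follows by scaling.\<close>

lemma rayleigh_minimizer:
  assumes n2: "n \<ge> 2"
  obtains f where "(\<Sum>i<n. f i) = 0" "(\<Sum>i<n. (f i)\<^sup>2) = 1"
    "\<And>g. (\<Sum>i<n. g i) = 0 \<Longrightarrow> dirichlet G f f * (\<Sum>i<n. (g i)\<^sup>2) \<le> dirichlet G g g"
proof -
  \<comment> \<open>Coordinates from \<open>n\<close> on are pinned to 0, so the box is compact by
    Tychonoff. The range from -1 to 1 is no restriction on vectors of norm 1.\<close>
  define S :: "nat \<Rightarrow> real set" where "S = (\<lambda>i. if i < n then {-1..1} else {0})"
  define K where "K = PiE UNIV S \<inter> ({f. (\<Sum>i<n. f i) = 0} \<inter> {f. (\<Sum>i<n. (f i)\<^sup>2) = 1})"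
  have coord: "continuous_on UNIV (\<lambda>f :: nat \<Rightarrow> real. f i)" for i
    by (rule continuous_on_product_coordinates)
  have "compactin (product_topology (\<lambda>i. euclidean) UNIV) (PiE UNIV S)"
    unfolding compactin_PiE by (auto simp: S_def)
  then have "compact (PiE UNIV S)"
    by (simp add: euclidean_product_topology)
  moreover have "closed ({f :: nat \<Rightarrow> real. (\<Sum>i<n. f i) = 0} \<inter> {f. (\<Sum>i<n. (f i)\<^sup>2) = 1})"
    by (intro closed_Int closed_Collect_eq continuous_intros coord)
  ultimately have K: "compact K"
    unfolding K_def by (rule compact_Int_closed)
  have pair: "(\<Sum>i<n. (h i :: real)) = h 0 + h 1" if "\<And>i. i \<ge> 2 \<Longrightarrow> h i = 0" for h
  proof -
    have "(\<Sum>i<n. h i) = (\<Sum>i\<in>{0, 1}. h i)"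
    proof (rule sum.mono_neutral_right)
      show "\<forall>i\<in>{..<n} - {0, 1}. h i = 0"
        by (intro ballI that) auto
    qed (use n2 in auto)
    then show ?thesis by simp
  qed
  \<comment> \<open>A mean-zero vector of norm 1, to show \<open>K\<close> nonempty; it needs two
    vertices.\<close>
  define e where "e = (\<lambda>i :: nat. if i = 0 then 1 / sqrt 2 else if i = 1 then - 1 / sqrt 2 else 0)"
  have "- 1 \<le> 1 / sqrt (2 :: real)"
    by (rule order_trans[of _ 0]) auto
  then have "e \<in> K"
    using n2 by (auto simp: K_def S_def pair e_def power_divide)
  then have Kne: "K \<noteq> {}" by blast
  have cont: "continuous_on K (\<lambda>f. dirichlet G f f)"
  proof -
    have "continuous_on UNIV (\<lambda>f. dirichlet G f f)"
      unfolding dirichlet_def case_prod_unfold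
      by (intro continuous_intros coord) auto
    then show ?thesis by (rule continuous_on_subset) auto
  qed
  obtain f where f: "f \<in> K" "\<And>h. h \<in> K \<Longrightarrow> dirichlet G f f \<le> dirichlet G h h"
    using continuous_attains_inf[OF K Kne cont] by blast
  show thesis
  proof (rule that)
    show "(\<Sum>i<n. f i) = 0" "(\<Sum>i<n. (f i)\<^sup>2) = 1"
      using f(1) by (auto simp: K_def)
  next
    fix g :: "nat \<Rightarrow> real"
    assume g: "(\<Sum>i<n. g i) = 0"
    define s where "s = (\<Sum>i<n. (g i)\<^sup>2)"
    show "dirichlet G f f * (\<Sum>i<n. (g i)\<^sup>2) \<le> dirichlet G g g"
    proof (cases "s = 0")
      case True
      then show ?thesis using dirichlet_nonneg[of g] by (simp add: s_def)
    next
      case False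
      moreover have "s \<ge> 0" by (auto simp: s_def intro: sum_nonneg)
      ultimately have s: "s > 0" by simp
      define h where "h = (\<lambda>i. if i < n then g i / sqrt s else 0)"
      have h1: "(\<Sum>i<n. (h i)\<^sup>2) = 1"
        using s by (simp add: h_def power_divide s_def[symmetric] flip: sum_divide_distrib)
      have h0: "(\<Sum>i<n. h i) = 0"
        using g by (simp add: h_def flip: sum_divide_distrib)
      have "h i \<in> S i" for i
      proof (cases "i < n")
        case True
        then have "(h i)\<^sup>2 \<le> (\<Sum>i<n. (h i)\<^sup>2)"
          by (intro member_le_sum) auto
        then have "\<bar>h i\<bar> \<le> 1" using h1 by (simp add: abs_square_le_1)
        then show ?thesis using True by (auto simp: S_def abs_le_iff)
      qed (simp add: S_def h_def)
      then have "h \<in> K" using h0 h1 by (auto simp: K_def)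
      then have "dirichlet G f f \<le> dirichlet G h h" by (rule f)
      also have "dirichlet G h h = dirichlet G (\<lambda>i. g i / sqrt s) (\<lambda>i. g i / sqrt s)"
        by (rule dirichlet_cong) (auto simp: h_def)
      also have "\<dots> = dirichlet G g g / s"
        using s by (simp add: dirichlet_def sum_divide_distrib case_prod_unfold mult.commute
            flip: diff_divide_distrib)
      finally show ?thesis using s by (simp add: field_simps flip: s_def)
    qed
  qed
qed

text \<open>First variation along the residual \<open>r\<close>. It has mean zero, so
  \<open>f + t * r\<close> is admissible, and the linear coefficient in \<open>t\<close> is twice
  the squared norm \<open>b\<close> of the residual, which must therefore vanish.\<close>

lemma rayleigh_minimizer_eigen:
  assumes f: "(\<Sum>i<n. f i) = 0" "(\<Sum>i<n. (f i)\<^sup>2) = 1"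
    and min: "\<And>g. (\<Sum>i<n. g i) = 0 \<Longrightarrow> dirichlet G f f * (\<Sum>i<n. (g i)\<^sup>2) \<le> dirichlet G g g"
    and i: "i < n"
  shows "laplacian G f i = dirichlet G f f * f i"
proof -
  define \<nu> where "\<nu> = dirichlet G f f"
  define r where "r = (\<lambda>i. laplacian G f i - \<nu> * f i)"
  define a where "a = dirichlet G r r - \<nu> * (\<Sum>i<n. (r i)\<^sup>2)"
  define b where "b = (\<Sum>i<n. (r i)\<^sup>2)"
  have r0: "(\<Sum>i<n. r i) = 0"
    by (simp add: r_def sum_subtractf sum_laplacian_zero f flip: sum_distrib_left)
  have b: "b = dirichlet G r f - \<nu> * (\<Sum>i<n. r i * f i)"
    unfolding b_def sum_laplacian[symmetric] sum_distrib_left sum_subtractf[symmetric]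
    by (rule sum.cong) (auto simp: r_def power2_eq_square algebra_simps)
  have quad: "0 \<le> 2 * t * b + t\<^sup>2 * a" for t
  proof -
    have "(\<Sum>i<n. f i + t * r i) = 0"
      by (simp add: sum.distrib f r0 flip: sum_distrib_left)
    from min[OF this] have "\<nu> * (\<Sum>i<n. (f i + t * r i)\<^sup>2) \<le>
        \<nu> + 2 * t * dirichlet G r f + t\<^sup>2 * dirichlet G r r"
      by (simp add: dirichlet_add_scaled flip: \<nu>_def)
    moreover have "(\<Sum>i<n. (f i + t * r i)\<^sup>2) =
        (\<Sum>i<n. (f i)\<^sup>2) + 2 * t * (\<Sum>i<n. r i * f i) + t\<^sup>2 * (\<Sum>i<n. (r i)\<^sup>2)"
      unfolding sum_distrib_left sum.distrib[symmetric]
      by (rule sum.cong) (auto simp: power2_eq_square algebra_simps)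
    ultimately show ?thesis
      by (simp add: f a_def b algebra_simps)
  qed
  have a: "a \<ge> 0"
    using min[OF r0] by (simp add: a_def \<nu>_def)
  \<comment> \<open>The choice \<open>t = - b * s\<close> makes the quadratic negative unless
    \<open>b = 0\<close>; the summand 1 covers \<open>a = 0\<close>.\<close>
  define s where "s = 1 / (a + 1)"
  have s: "s > 0" "s * a \<le> 1" using a by (auto simp: s_def)
  have "0 \<le> 2 * (- b * s) * b + (- b * s)\<^sup>2 * a" by (rule quad)
  also have "\<dots> = - (b\<^sup>2 * (s * (2 - s * a)))"
    by (simp add: algebra_simps power2_eq_square)
  finally have "b\<^sup>2 * (s * (2 - s * a)) \<le> 0" by simp
  moreover have "s * (2 - s * a) > 0" using s by simp
  ultimately have "b = 0"
    using mult_pos_pos[of "b\<^sup>2" "s * (2 - s * a)"] by fastforce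
  then have "r i = 0" using sum_sq_pos[OF i, of r] unfolding b_def by force
  then show ?thesis by (simp add: r_def \<nu>_def)
qed

lemma positive_in_proots:
  assumes n2: "n \<ge> 2"
  obtains \<nu> where "\<nu> > 0" "\<nu> \<in># proots (char_poly (laplacian_mat G))"
    "\<And>g. (\<Sum>i<n. g i) = 0 \<Longrightarrow> \<nu> * (\<Sum>i<n. (g i)\<^sup>2) \<le> dirichlet G g g"
proof -
  obtain f where f: "(\<Sum>i<n. f i) = 0" "(\<Sum>i<n. (f i)\<^sup>2) = 1"
    "\<And>g. (\<Sum>i<n. g i) = 0 \<Longrightarrow> dirichlet G f f * (\<Sum>i<n. (g i)\<^sup>2) \<le> dirichlet G g g"
    using rayleigh_minimizer[OF n2] by metis
  have nz: "\<exists>i<n. f i \<noteq> 0"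
    using f(2) by (metis (no_types, lifting) lessThan_iff sum.neutral zero_neq_one zero_power2)
  show thesis
  proof (rule that[OF _ _ f(3)])
    show "dirichlet G f f \<in># proots (char_poly (laplacian_mat G))"
      unfolding in_proots_iff using nz rayleigh_minimizer_eigen[OF f] by blast
    have "dirichlet G f f \<noteq> 0"
    proof
      assume "dirichlet G f f = 0"
      then have c: "f i = f 0" if "i < n" for i
        using dirichlet_zero_const[of f 0 i] n_pos that by simp
      have "(\<Sum>i<n. f i) = (\<Sum>i<n. f 0)"
        by (rule sum.cong[OF refl]) (rule c, simp)
      then have "f 0 = 0" using f(1) n_pos by simp
      then show False using nz c by metis
    qed
    then show "dirichlet G f f > 0" using dirichlet_nonneg[of f] by simp
  qed
qed

text \<open>The roots 0 and \<open>\<nu> > 0\<close> are distinct, so one of them stands at a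
  position \<open>\<ge> 1\<close> in the sorted list; both are at most \<open>\<nu>\<close>, hence
  so is the entry at index 1.\<close>

lemma algebraic_connectivity_le:
  assumes n2: "n \<ge> 2" and g: "(\<Sum>i<n. g i) = 0"
  shows "algebraic_connectivity G * (\<Sum>i<n. (g i)\<^sup>2) \<le> dirichlet G g g"
proof -
  obtain \<nu> where \<nu>: "\<nu> > 0" "\<nu> \<in># proots (char_poly (laplacian_mat G))"
    "\<nu> * (\<Sum>i<n. (g i)\<^sup>2) \<le> dirichlet G g g"
    using positive_in_proots[OF n2] g by metis
  define xs where "xs = sorted_eigenvalues (laplacian_mat G)"
  have xs: "sorted xs" "set xs = set_mset (proots (char_poly (laplacian_mat G)))"
    by (auto simp: xs_def sorted_eigenvalues_def)
  obtain i j where i: "i < length xs" "xs ! i = 0" and j: "j < length xs" "xs ! j = \<nu>"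
    using \<nu>(2) zero_in_proots xs(2) by (metis in_set_conv_nth)
  have "xs ! 1 \<le> \<nu>"
  proof (cases "j = 0")
    case True
    then have "i \<ge> 1" using i j \<nu>(1) by (cases i) auto
    then show ?thesis using sorted_nth_mono[OF xs(1), of 1 i] i \<nu>(1) by simp
  next
    case False
    then show ?thesis using sorted_nth_mono[OF xs(1), of 1 j] j by simp
  qed
  then have "algebraic_connectivity G * (\<Sum>i<n. (g i)\<^sup>2) \<le> \<nu> * (\<Sum>i<n. (g i)\<^sup>2)"
    unfolding algebraic_connectivity_def xs_def by (intro mult_right_mono sum_nonneg) auto
  then show ?thesis using \<nu>(3) by simp
qed

text \<open>As 0 is a simple root, the entry at index 1 is nonzero. Its eigenfunction has mean zero
  because every Laplacian sums to 0.\<close>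

lemma algebraic_connectivity_attained:
  assumes n2: "n \<ge> 2"
  obtains f where "(\<Sum>i<n. f i) = 0" "(\<Sum>i<n. (f i)\<^sup>2) > 0"
    "dirichlet G f f = algebraic_connectivity G * (\<Sum>i<n. (f i)\<^sup>2)"
proof -
  define P where "P = proots (char_poly (laplacian_mat G))"
  define xs where "xs = sorted_list_of_multiset P"
  have xs: "sorted xs" "set xs = set_mset P" "mset xs = P"
    by (auto simp: xs_def)
  have ac: "algebraic_connectivity G = xs ! 1"
    by (simp add: algebraic_connectivity_def sorted_eigenvalues_def xs_def P_def)
  obtain \<nu> where \<nu>: "\<nu> > 0" "\<nu> \<in># P"
    using positive_in_proots[OF n2] P_def by metis
  then obtain i j where ij: "i < length xs" "xs ! i = 0" "j < length xs" "xs ! j = \<nu>"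
    using zero_in_proots xs(2) by (metis P_def in_set_conv_nth)
  then have "i \<noteq> j" using \<nu>(1) by auto
  then have len: "length xs > 1" using ij by auto
  then obtain x y zs where xyz: "xs = x # y # zs"
    by (metis One_nat_def list.size(3,4) length_Cons less_one not_less_zero list.exhaust less_irrefl)
  have mem: "x \<in># P" "y \<in># P" using xs(2) xyz by auto
  have "y \<noteq> 0"
  proof
    assume "y = 0"
    moreover have "x \<le> y" using xs(1) xyz by simp
    moreover have "x \<ge> 0" using mem proots_nonneg P_def by simp
    ultimately have "count (mset xs) 0 \<ge> 2" using xyz by simp
    then show False
      using order_zero char_poly_nz by (simp add: xs(3) P_def)
  qed
  obtain f where f: "\<exists>i<n. f i \<noteq> 0" "\<forall>i<n. laplacian G f i = y * f i"
    using mem in_proots_iff P_def by metis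
  have "y * (\<Sum>i<n. f i) = 0"
    using sum_laplacian_zero[of f] f(2) by (simp add: sum_distrib_left)
  then have "(\<Sum>i<n. f i) = 0" using \<open>y \<noteq> 0\<close> by simp
  then show thesis
    using that[of f] dirichlet_eigen[OF f(2)] f(1) sum_sq_pos ac xyz by auto
qed

lemma algebraic_connectivity_nonneg:
  assumes n2: "n \<ge> 2"
  shows "algebraic_connectivity G \<ge> 0"
proof -
  obtain f where "(\<Sum>i<n. (f i)\<^sup>2) > 0"
    "dirichlet G f f = algebraic_connectivity G * (\<Sum>i<n. (f i)\<^sup>2)"
    using algebraic_connectivity_attained[OF n2] by metis
  then show ?thesis
    using dirichlet_nonneg[of f] by (simp add: zero_le_mult_iff)
qed

end

lemma connected_graph_on_cubic: "G \<in> connected_cubic_graphs n \<Longrightarrow> connected_graph_on G n"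
  by (simp add: connected_cubic_graphs_def connected_graph_on_def)


section \<open>The sharp Poincare inequality on a path\<close>

text \<open>Discrete ground state substitution: the positive Dirichlet eigenvector
  \<open>s j = sin (pi j / n)\<close> turns the cross terms \<open>2 a\<^sub>j a\<^sub>j\<^sub>+\<^sub>1\<close> into squares.\<close>

lemma path_dirichlet_ineq:
  fixes a :: "nat \<Rightarrow> real"
  assumes n: "n \<ge> 2" and a0: "a 0 = 0" and an: "a n = 0"
  shows "(2 - 2 * cos (pi / n)) * (\<Sum>j<n. (a j)\<^sup>2) \<le> (\<Sum>j<n. (a (Suc j) - a j)\<^sup>2)"
proof -
  obtain m where m: "n = Suc (Suc m)"
    using n by (metis add_2_eq_Suc le_Suc_ex)
  define s where "s = (\<lambda>j :: nat. sin (pi * j / n))"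
  have s_pos: "s j > 0" if "0 < j" "j < n" for j
    unfolding s_def using that by (intro sin_gt_zero) (auto simp: field_simps)
  have rec: "s (Suc (Suc j)) + s j = 2 * cos (pi / n) * s (Suc j)" for j
  proof -
    have "pi * real (Suc (Suc j)) / n = pi * real (Suc j) / n + pi / n"
      "pi * real j / n = pi * real (Suc j) / n - pi / n"
      using n by (simp_all add: field_simps)
    then show ?thesis by (simp add: s_def sin_add sin_diff)
  qed
  have s_ends: "s 0 = 0" "s n = 0"
    using n by (auto simp: s_def)
  have amgm: "2 * a (Suc j) * a (Suc (Suc j)) \<le>
      (a (Suc j))\<^sup>2 * (s (Suc (Suc j)) / s (Suc j)) + (a (Suc (Suc j)))\<^sup>2 * (s (Suc j) / s (Suc (Suc j)))"
    if "j < m" for j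
  proof -
    define x y where "x = s (Suc j)" and "y = s (Suc (Suc j))"
    have xy: "x > 0" "y > 0" using that m by (auto simp: x_def y_def intro!: s_pos)
    have "0 \<le> (a (Suc j) * y - a (Suc (Suc j)) * x)\<^sup>2 / (x * y)"
      using xy by simp
    also have "\<dots> = (a (Suc j))\<^sup>2 * (y / x) + (a (Suc (Suc j)))\<^sup>2 * (x / y) - 2 * a (Suc j) * a (Suc (Suc j))"
      using xy by (simp add: field_simps power2_eq_square)
    finally show ?thesis by (simp add: x_def y_def)
  qed
  have ends: "(\<Sum>j<n. h j) = h 0 + (\<Sum>j<m. h (Suc j)) + h (Suc m)" for h :: "nat \<Rightarrow> real"
    unfolding m by (subst sum.lessThan_Suc_shift) simp
  have cross: "(\<Sum>j<n. 2 * a j * a (Suc j)) \<le> 2 * cos (pi / n) * (\<Sum>j<n. (a j)\<^sup>2)"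
  proof -
    have "(\<Sum>j<n. 2 * a j * a (Suc j)) = (\<Sum>j<m. 2 * a (Suc j) * a (Suc (Suc j)))"
      using an unfolding ends by (simp add: a0 m)
    also have "\<dots> \<le> (\<Sum>j<m. (a (Suc j))\<^sup>2 * (s (Suc (Suc j)) / s (Suc j)))
        + (\<Sum>j<m. (a (Suc (Suc j)))\<^sup>2 * (s (Suc j) / s (Suc (Suc j))))"
      unfolding sum.distrib[symmetric] by (intro sum_mono amgm) simp
    \<comment> \<open>Here and in the next step the added term vanishes since \<open>s n = 0\<close>
      and \<open>s 0 = 0\<close>. Over the common range the two weights of \<open>a (Suc j)\<close>
      add up to \<open>2 * cos (pi / n)\<close> by \<open>rec\<close>.\<close>
    also have "(\<Sum>j<m. (a (Suc j))\<^sup>2 * (s (Suc (Suc j)) / s (Suc j))) =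
        (\<Sum>j<Suc m. (a (Suc j))\<^sup>2 * (s (Suc (Suc j)) / s (Suc j)))"
      using s_ends m by simp
    also have "(\<Sum>j<m. (a (Suc (Suc j)))\<^sup>2 * (s (Suc j) / s (Suc (Suc j)))) =
        (\<Sum>j<Suc m. (a (Suc j))\<^sup>2 * (s j / s (Suc j)))"
      using s_ends by (simp add: sum.lessThan_Suc_shift del: sum.lessThan_Suc)
    also have "(\<Sum>j<Suc m. (a (Suc j))\<^sup>2 * (s (Suc (Suc j)) / s (Suc j))) + \<dots> =
        (\<Sum>j<Suc m. (a (Suc j))\<^sup>2 * (2 * cos (pi / n)))"
      unfolding sum.distrib[symmetric]
    proof (rule sum.cong)
      fix j assume "j \<in> {..<Suc m}"
      then have "s (Suc j) > 0" using m by (intro s_pos) auto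
      then have "s (Suc (Suc j)) / s (Suc j) + s j / s (Suc j) = 2 * cos (pi / n)"
        using rec[of j] by (simp flip: add_divide_distrib)
      then show "(a (Suc j))\<^sup>2 * (s (Suc (Suc j)) / s (Suc j)) + (a (Suc j))\<^sup>2 * (s j / s (Suc j)) =
          (a (Suc j))\<^sup>2 * (2 * cos (pi / n))"
        by (simp only: distrib_left[symmetric])
    qed simp
    also have "\<dots> = 2 * cos (pi / n) * (\<Sum>j<Suc m. (a (Suc j))\<^sup>2)"
      by (simp add: sum_distrib_left mult.commute del: sum.lessThan_Suc)
    also have "(\<Sum>j<Suc m. (a (Suc j))\<^sup>2) = (\<Sum>j<n. (a j)\<^sup>2)"
      unfolding m by (subst (2) sum.lessThan_Suc_shift) (simp add: a0)
    finally show ?thesis .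
  qed
  have "(\<Sum>j<n. (a (Suc j))\<^sup>2) = (\<Sum>j<n. (a j)\<^sup>2)"
    using sum.lessThan_Suc_shift[of "\<lambda>j. (a j)\<^sup>2" n] by (simp add: a0 an)
  then have "(\<Sum>j<n. (a (Suc j) - a j)\<^sup>2) = 2 * (\<Sum>j<n. (a j)\<^sup>2) - (\<Sum>j<n. 2 * a j * a (Suc j))"
    by (simp add: power2_diff sum.distrib sum_subtractf mult.commute mult.left_commute)
  then show ?thesis using cross by (simp add: algebra_simps)
qed

text \<open>The partial sums of a mean-zero function vanish at both ends, so the Neumann
  inequality is dual to the Dirichlet inequality.\<close>

lemma path_poincare:
  fixes h :: "nat \<Rightarrow> real"
  assumes n: "n \<ge> 2" and mean: "(\<Sum>j<n. h j) = 0"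
  shows "(2 - 2 * cos (pi / n)) * (\<Sum>j<n. (h j)\<^sup>2) \<le> (\<Sum>j<n - 1. (h (Suc j) - h j)\<^sup>2)"
proof -
  define S where "S = (\<lambda>j. \<Sum>i<j. h i)"
  define l where "l = 2 - 2 * cos (pi / n)"
  define X where "X = (\<Sum>j<n. (h j)\<^sup>2)"
  define Y where "Y = (\<Sum>j<n - 1. (h (Suc j) - h j)\<^sup>2)"
  define Z where "Z = (\<Sum>j<n. (S j)\<^sup>2)"
  obtain m where m: "n = Suc m" using n by (cases n) auto
  have "cos (pi / n) \<le> 1" by simp
  then have l: "l \<ge> 0" by (simp add: l_def)
  have ends: "S 0 = 0" "S n = 0" using mean by (auto simp: S_def)
  have XS: "X = (\<Sum>j<n. (S (Suc j) - S j)\<^sup>2)"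
    by (simp add: X_def S_def)
  have SX: "l * Z \<le> X"
    unfolding XS l_def Z_def by (rule path_dirichlet_ineq[OF n ends])
  have parts: "(\<Sum>j<k. h j * (S (Suc j) - S j)) = h k * S k - (\<Sum>j<k. S (Suc j) * (h (Suc j) - h j))" for k
    by (induction k) (auto simp: ends algebra_simps)
  have "X = (\<Sum>j<n. h j * (S (Suc j) - S j))"
    by (simp add: X_def S_def power2_eq_square)
  also have "\<dots> = h m * (S (Suc m) - S m) + h m * S m - (\<Sum>j<m. S (Suc j) * (h (Suc j) - h j))"
    unfolding m sum.lessThan_Suc parts[of m] by simp
  also have "\<dots> = - (\<Sum>j<m. S (Suc j) * (h (Suc j) - h j))"
    using ends m by (simp add: algebra_simps)
  finally have X: "X = - (\<Sum>j<m. S (Suc j) * (h (Suc j) - h j))" .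
  \<comment> \<open>By parts, \<open>X\<close> pairs partial sums with increments, so Cauchy-Schwarz
    gives \<open>Z * Y\<close>; with \<open>l * Z \<le> X\<close> one factor \<open>X\<close>
    cancels.\<close>
  have "X\<^sup>2 = (\<Sum>j<m. S (Suc j) * (h (Suc j) - h j))\<^sup>2"
    unfolding X by simp
  also have "\<dots> \<le> (\<Sum>j<m. (S (Suc j))\<^sup>2) * (\<Sum>j<m. (h (Suc j) - h j)\<^sup>2)"
    by (rule Cauchy_Schwarz_ineq_sum)
  also have "(\<Sum>j<m. (S (Suc j))\<^sup>2) = Z"
    unfolding Z_def m by (subst sum.lessThan_Suc_shift) (simp add: ends)
  also have "(\<Sum>j<m. (h (Suc j) - h j)\<^sup>2) = Y"
    by (simp add: Y_def m)
  finally have CS: "X\<^sup>2 \<le> Z * Y" .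
  have Y: "Y \<ge> 0" by (auto simp: Y_def intro: sum_nonneg)
  have "l * X \<le> Y"
  proof (cases "X = 0")
    case False
    moreover have "X \<ge> 0" by (auto simp: X_def intro: sum_nonneg)
    ultimately have Xp: "X > 0" by simp
    have "X * (l * X) = l * X\<^sup>2" by (simp add: power2_eq_square)
    also have "\<dots> \<le> l * (Z * Y)" using CS l by (rule mult_left_mono)
    also have "\<dots> \<le> X * Y" using mult_right_mono[OF SX Y] by (simp add: mult.assoc)
    finally show ?thesis using Xp by simp
  qed (use Y in simp)
  then show ?thesis by (simp add: l_def X_def Y_def)
qed

section \<open>Cubic graphs sorted by a function\<close>

text \<open>\<open>R\<close> is the graph with every vertex renamed to its rank under
  \<open>f\<close>. Connectedness is kept only as \<open>R_conn\<close>: some edge leaves every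
  nonempty proper initial segment.\<close>

locale sorted_cubic =
  fixes R :: "(nat \<times> nat) set" and n :: nat and f :: "nat \<Rightarrow> real"
  assumes R_sub: "R \<subseteq> {..<n} \<times> {..<n}"
    and R_sym: "(i, j) \<in> R \<Longrightarrow> (j, i) \<in> R"
    and R_irrefl: "(i, i) \<notin> R"
    and R_deg: "i < n \<Longrightarrow> card {j. (i, j) \<in> R} = 3"
    and R_conn: "0 < k \<Longrightarrow> k < n \<Longrightarrow> \<exists>i j. (i, j) \<in> R \<and> i < k \<and> k \<le> j"
    and f_mono: "i \<le> j \<Longrightarrow> j < n \<Longrightarrow> f i \<le> f j"
begin

definition clamp :: "nat \<Rightarrow> nat \<Rightarrow> nat \<Rightarrow> nat" where
  "clamp p q i = max p (min q i)"

definition edges :: "(nat \<times> nat) set" where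
  "edges = {(i, j) \<in> R. i < j}"

text \<open>Clamping cuts every edge at \<open>p\<close> and \<open>q\<close>. Since \<open>f\<close> is increasing along the order, the pieces
  of an edge contribute with the same sign, which makes the energy superadditive over segments.\<close>

definition clamped_energy :: "nat \<Rightarrow> nat \<Rightarrow> real" where
  "clamped_energy p q = (\<Sum>(i, j)\<in>edges. (f (clamp p q j) - f (clamp p q i))\<^sup>2)"

text \<open>The boundary of the first \<open>k\<close> vertices. The gap between positions
  \<open>k\<close> and \<open>k + 1\<close> is therefore crossed by
  \<open>cut (Suc k)\<close>.\<close>

definition cut :: "nat \<Rightarrow> (nat \<times> nat) set" where
  "cut k = {(i, j) \<in> R. i < k \<and> k \<le> j}"

definition inner_edges :: "nat \<Rightarrow> nat \<Rightarrow> (nat \<times> nat) set" where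
  "inner_edges k l = {(i, j) \<in> R. k \<le> i \<and> i < j \<and> j < l}"

text \<open>By the Dirichlet principle, effective resistance is the supremum of
  \<open>(f q - f p)\<^sup>2\<close> divided by the energy, with everything up to \<open>p\<close>
  and everything from \<open>q\<close> on merged. Here the bound is asserted for the given
  \<open>f\<close> only.\<close>

definition resistance_le :: "nat \<Rightarrow> nat \<Rightarrow> real \<Rightarrow> bool" where
  "resistance_le p q r \<longleftrightarrow> (f q - f p)\<^sup>2 \<le> r * clamped_energy p q"

lemma finite_R: "finite R"
  by (rule finite_subset[OF R_sub]) simp

lemma finite_edges: "finite edges" and finite_cut: "finite (cut k)"
  and finite_inner: "finite (inner_edges k l)"
  by (auto simp: edges_def cut_def inner_edges_def intro: finite_subset[OF _ finite_R])

lemma R_less: "(i, j) \<in> R \<Longrightarrow> i < n \<and> j < n"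
  using R_sub by auto

lemma clamped_energy_nonneg: "clamped_energy p q \<ge> 0"
  by (auto simp: clamped_energy_def intro!: sum_nonneg)

lemma clamped_energy_add:
  assumes "p \<le> q" "q \<le> r" "r < n"
  shows "clamped_energy p q + clamped_energy q r \<le> clamped_energy p r"
  unfolding clamped_energy_def sum.distrib[symmetric]
proof (rule sum_mono)
  fix e assume "e \<in> edges"
  then obtain i j where e: "e = (i, j)" "i < j" by (auto simp: edges_def)
  have split: "f (clamp p r x) = f (clamp p q x) + f (clamp q r x) - f q" for x
    using assms by (cases "x \<le> q") (auto simp: clamp_def max_def min_def)
  have mono: "f (clamp s t i) \<le> f (clamp s t j)" if "s \<le> t" "t < n" for s t
    using that e by (intro f_mono) (auto simp: clamp_def)
  define u v where "u = f (clamp p q j) - f (clamp p q i)" and "v = f (clamp q r j) - f (clamp q r i)"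
  have "0 \<le> u" "0 \<le> v" using mono assms by (auto simp: u_def v_def)
  then have "u\<^sup>2 + v\<^sup>2 \<le> (u + v)\<^sup>2" by (simp add: power2_sum)
  also have "u + v = f (clamp p r j) - f (clamp p r i)"
    by (simp add: u_def v_def split)
  finally show "(case e of (i, j) \<Rightarrow> (f (clamp p q j) - f (clamp p q i))\<^sup>2) +
      (case e of (i, j) \<Rightarrow> (f (clamp q r j) - f (clamp q r i))\<^sup>2)
      \<le> (case e of (i, j) \<Rightarrow> (f (clamp p r j) - f (clamp p r i))\<^sup>2)"
    by (simp add: e u_def v_def)
qed

lemma clamped_energy_ge:
  assumes "S \<subseteq> edges"
  shows "(\<Sum>(i, j)\<in>S. (f (clamp p q j) - f (clamp p q i))\<^sup>2) \<le> clamped_energy p q"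
  unfolding clamped_energy_def using assms finite_edges by (intro sum_mono2) auto

lemma clamped_energy_Suc:
  "clamped_energy k (Suc k) = card (cut (Suc k)) * (f (Suc k) - f k)\<^sup>2"
proof -
  have cl: "clamp k (Suc k) i = (if i \<le> k then k else Suc k)" for i
    by (auto simp: clamp_def)
  have "clamped_energy k (Suc k) =
      (\<Sum>(i, j)\<in>cut (Suc k). (f (clamp k (Suc k) j) - f (clamp k (Suc k) i))\<^sup>2)"
    unfolding clamped_energy_def
    by (rule sum.mono_neutral_right)
      (use finite_edges in \<open>auto simp: edges_def cut_def cl split: if_splits\<close>)
  also have "\<dots> = (\<Sum>e\<in>cut (Suc k). (f (Suc k) - f k)\<^sup>2)"
    by (rule sum.cong) (auto simp: cut_def cl)
  finally show ?thesis by simp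
qed

lemma resistance_le_mono:
  "resistance_le p q r \<Longrightarrow> r \<le> s \<Longrightarrow> resistance_le p q s"
  unfolding resistance_le_def using clamped_energy_nonneg[of p q]
  by (meson mult_right_mono order_trans)

text \<open>Series law: AM-GM gives \<open>2 * (x * y) \<le> r * B + s * A\<close>, the mixed part
  of \<open>(r + s) * (A + B)\<close>.\<close>

lemma resistance_le_series:
  assumes pq: "resistance_le p q r" and qs: "resistance_le q t s"
    and "0 \<le> r" "0 \<le> s" and ord: "p \<le> q" "q \<le> t" "t < n"
  shows "resistance_le p t (r + s)"
proof -
  define x y A B where "x = f q - f p" and "y = f t - f q"
    and "A = clamped_energy p q" and "B = clamped_energy q t"
  have xA: "x\<^sup>2 \<le> r * A" and yB: "y\<^sup>2 \<le> s * B"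
    using pq qs by (auto simp: resistance_le_def x_def y_def A_def B_def)
  have AB: "A \<ge> 0" "B \<ge> 0" by (auto simp: A_def B_def clamped_energy_nonneg)
  have "(x * y)\<^sup>2 \<le> (r * A) * (s * B)"
    unfolding power_mult_distrib by (intro mult_mono xA yB) (use AB assms in auto)
  also have "\<dots> \<le> ((r * B + s * A) / 2)\<^sup>2"
    using zero_le_power2[of "(r * B - s * A) / 2"]
    by (simp add: power2_eq_square field_simps)
  finally have "\<bar>x * y\<bar> \<le> (r * B + s * A) / 2"
    using AB assms by (subst (asm) abs_le_square_iff[symmetric]) (auto simp: abs_mult)
  then have "2 * (x * y) \<le> r * B + s * A" using abs_le_D1 by fastforce
  then have "(x + y)\<^sup>2 \<le> (r + s) * (A + B)"
    using xA yB by (simp add: power2_sum algebra_simps)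
  also have "\<dots> \<le> (r + s) * clamped_energy p t"
    using clamped_energy_add[OF ord] assms by (intro mult_left_mono) (auto simp: A_def B_def)
  finally show ?thesis by (simp add: resistance_le_def x_def y_def)
qed

text \<open>Parallel law: at least \<open>m\<close> edges of resistance 1 cross the gap.\<close>

lemma resistance_le_Suc:
  assumes "m \<le> card (cut (Suc k))" "m > 0"
  shows "resistance_le k (Suc k) (1 / m)"
proof -
  have "real m * (f (Suc k) - f k)\<^sup>2 \<le> card (cut (Suc k)) * (f (Suc k) - f k)\<^sup>2"
    using assms by (intro mult_right_mono) auto
  then show ?thesis
    using assms by (simp add: resistance_le_def clamped_energy_Suc field_simps)
qed

section \<open>Degree counts for cuts and blocks\<close>

lemma out_arcs_block:
  assumes "l \<le> n"
  shows "card {(i, j) \<in> R. k \<le> i \<and> i < l} = 3 * (l - k)"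
proof -
  have "{(i, j) \<in> R. k \<le> i \<and> i < l} = (SIGMA i:{k..<l}. {j. (i, j) \<in> R})"
    by auto
  moreover have "finite {j. (i, j) \<in> R}" for i
    by (rule finite_subset[of _ "{..<n}"]) (use R_sub in auto)
  ultimately show ?thesis
    using assms by (simp add: R_deg card_SigmaI)
qed

lemma card_inner_flip: "card {(i, j) \<in> R. k \<le> j \<and> j < i \<and> i < l} = card (inner_edges k l)"
proof -
  have "{(i, j) \<in> R. k \<le> j \<and> j < i \<and> i < l} = prod.swap ` inner_edges k l"
    by (auto simp: inner_edges_def image_iff intro: R_sym)
  then show ?thesis by (simp add: card_image)
qed

lemma handshake_cut:
  assumes "l \<le> n"
  shows "3 * l = 2 * card (inner_edges 0 l) + card (cut l)"
proof -
  have "{(i, j) \<in> R. 0 \<le> i \<and> i < l} = (inner_edges 0 l \<union> {(i, j) \<in> R. 0 \<le> j \<and> j < i \<and> i < l}) \<union> cut l"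
    using R_irrefl by (auto simp: inner_edges_def cut_def) (metis linorder_neqE_nat)
  moreover have "card \<dots> = card (inner_edges 0 l \<union> {(i, j) \<in> R. 0 \<le> j \<and> j < i \<and> i < l}) + card (cut l)"
    by (rule card_Un_disjoint)
      (auto simp: finite_cut finite_inner inner_edges_def cut_def intro: finite_subset[OF _ finite_R])
  moreover have "card (inner_edges 0 l \<union> {(i, j) \<in> R. 0 \<le> j \<and> j < i \<and> i < l}) =
      card (inner_edges 0 l) + card {(i, j) \<in> R. 0 \<le> j \<and> j < i \<and> i < l}"
    by (rule card_Un_disjoint)
      (auto simp: finite_inner inner_edges_def intro: finite_subset[OF _ finite_R])
  ultimately show ?thesis
    using out_arcs_block[OF assms, of 0] card_inner_flip[of 0 l] by simp
qed

text \<open>Only an inequality, since an edge that passes over the block belongs to both cuts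
  without having an end in the block.\<close>

lemma handshake_block:
  assumes "k \<le> l" "l \<le> n"
  shows "3 * (l - k) \<le> 2 * card (inner_edges k l) + card (cut k) + card (cut l)"
proof -
  have "{(i, j) \<in> R. k \<le> i \<and> i < l} \<subseteq>
      ((inner_edges k l \<union> {(i, j) \<in> R. k \<le> j \<and> j < i \<and> i < l}) \<union> prod.swap ` cut k) \<union> cut l"
    (is "?A \<subseteq> ?B")
  proof
    fix e assume "e \<in> ?A"
    then obtain i j where e: "e = (i, j)" "(i, j) \<in> R" "k \<le> i" "i < l" by auto
    have "i \<noteq> j" using e R_irrefl by auto
    then consider "j < k" | "k \<le> j" "j < i" | "i < j" "j < l" | "l \<le> j" by linarith
    then show "e \<in> ?B"
    proof cases
      case 1
      then have "(j, i) \<in> cut k" using e R_sym by (auto simp: cut_def)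
      then show ?thesis using e by force
    qed (use e in \<open>auto simp: inner_edges_def cut_def\<close>)
  qed
  then have "card ?A \<le> card ?B"
    by (intro card_mono) (auto simp: finite_cut finite_inner intro: finite_subset[OF _ finite_R])
  also have "\<dots> \<le> card (inner_edges k l) + card {(i, j) \<in> R. k \<le> j \<and> j < i \<and> i < l}
      + card (prod.swap ` cut k) + card (cut l)"
    by (intro card_Un_le[THEN order_trans] add_mono order_refl)
  also have "card (prod.swap ` cut k) = card (cut k)" by (simp add: card_image)
  finally show ?thesis
    using out_arcs_block[OF assms(2), of k] by (simp add: card_inner_flip)
qed

lemma cut_pos: "0 < k \<Longrightarrow> k < n \<Longrightarrow> card (cut k) \<ge> 1"
  using R_conn[of k] finite_cut[of k] by (auto simp: cut_def Suc_le_eq card_gt_0_iff)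

lemma even_cut: "k \<le> n \<Longrightarrow> even (card (cut k)) \<longleftrightarrow> even k"
  using handshake_cut[of k] by presburger

lemma cut_odd_ge:
  assumes "odd k" "k < n" "card (cut k) \<noteq> 1"
  shows "card (cut k) \<ge> 3"
  using assms even_cut[of k] cut_pos[of k] by (cases "k = 0") (auto, presburger)

lemma cut_even_ge:
  assumes "even k" "0 < k" "k < n"
  shows "card (cut k) \<ge> 2"
proof -
  have "even (card (cut k))" "card (cut k) \<ge> 1"
    using assms even_cut[of k] cut_pos[of k] by auto
  then show ?thesis by presburger
qed

lemma cut_even_ge4:
  assumes "even k" "0 < k" "k < n" "card (cut k) \<noteq> 2"
  shows "card (cut k) \<ge> 4"
proof -
  have "even (card (cut k))" "card (cut k) \<ge> 2"
    using assms even_cut[of k] cut_even_ge[of k] by auto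
  then show ?thesis using assms(4) by presburger
qed

text \<open>Simplicity enters here: two vertices span at most one edge, so their degree sum gives
  \<open>6 \<le> 2 + 1 + card (cut (k + 2))\<close>. Thus consecutive odd cuts are never both
  bridges.\<close>

lemma cut_two_after_bridge:
  assumes "card (cut k) = 1" "k + 2 \<le> n"
  shows "card (cut (k + 2)) \<ge> 3"
proof -
  have "inner_edges k (k + 2) \<subseteq> {(k, k + 1)}" by (auto simp: inner_edges_def)
  then have "card (inner_edges k (k + 2)) \<le> 1"
    using card_mono[of "{(k, k + 1)}"] by simp
  then show ?thesis using handshake_block[of k "k + 2"] assms by simp
qed

text \<open>The count \<open>9 \<le> 2 * 3 + 1 + 2\<close> is tight, so the three vertices form a
  triangle. Its two edges at \<open>k\<close> exhaust \<open>cut (k + 1)\<close>, so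
  \<open>k + 1\<close> and \<open>k + 2\<close> have no neighbour below \<open>k\<close> and send
  their third edges to the right. After clamping, \<open>k\<close> and \<open>k + 3\<close> are the
  non-adjacent vertices of K4 minus an edge, at resistance 1.\<close>

lemma triangle_block:
  assumes c: "card (cut k) = 1" "card (cut (k + 1)) = 2" "card (cut (k + 3)) = 2" and k: "k + 3 < n"
  shows "resistance_le k (k + 3) 1"
proof -
  let ?P = "{(k, k + 1), (k, k + 2), (k + 1, k + 2)}"
  have sub: "inner_edges k (k + 3) \<subseteq> ?P" by (auto simp: inner_edges_def)
  have "card ?P = 3" by simp
  moreover have "card (inner_edges k (k + 3)) \<ge> 3"
    using handshake_block[of k "k + 3"] c k by simp
  ultimately have "inner_edges k (k + 3) = ?P"
    using sub by (intro card_seteq) auto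
  then have tri: "(k, k + 1) \<in> R" "(k, k + 2) \<in> R" "(k + 1, k + 2) \<in> R"
    by (auto simp: inner_edges_def)
  have "{(k, k + 1), (k, k + 2)} \<subseteq> cut (k + 1)" using tri by (auto simp: cut_def)
  moreover have "card (cut (k + 1)) \<le> card {(k, k + 1), (k, k + 2)}" using c by simp
  ultimately have cut: "cut (k + 1) = {(k, k + 1), (k, k + 2)}"
    using finite_cut card_seteq by metis
  have right: "\<exists>x\<ge>k + 3. (v, x) \<in> R" if v: "v = k + 1 \<and> w = k + 2 \<or> v = k + 2 \<and> w = k + 1" for v w
  proof -
    have "card {j. (v, j) \<in> R} = 3" using v k R_deg by auto
    moreover have "card {k, w} \<le> 2" by (simp add: card_insert_if)
    ultimately have "\<not> {j. (v, j) \<in> R} \<subseteq> {k, w}"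
      using card_mono[of "{k, w}" "{j. (v, j) \<in> R}"] by auto
    then obtain x where x: "(v, x) \<in> R" "x \<noteq> k" "x \<noteq> w" by auto
    have "x \<noteq> v" using x R_irrefl by auto
    moreover have "\<not> x < k"
    proof
      assume "x < k"
      then have "(x, v) \<in> cut (k + 1)" using x v R_sym by (auto simp: cut_def)
      then show False using \<open>x < k\<close> unfolding cut by auto
    qed
    ultimately have "x \<ge> k + 3" using x v by linarith
    then show ?thesis using x by blast
  qed
  obtain x y where xy: "x \<ge> k + 3" "(k + 1, x) \<in> R" "y \<ge> k + 3" "(k + 2, y) \<in> R"
    using right[of "k + 1" "k + 2"] right[of "k + 2" "k + 1"] by auto
  let ?S = "{(k, k + 1), (k, k + 2), (k + 1, k + 2), (k + 1, x), (k + 2, y)}"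
  have "?S \<subseteq> edges" using tri xy by (auto simp: edges_def)
  from clamped_energy_ge[OF this, of k "k + 3"]
  have "(f (k + 1) - f k)\<^sup>2 + (f (k + 2) - f k)\<^sup>2 + (f (k + 2) - f (k + 1))\<^sup>2
      + (f (k + 3) - f (k + 1))\<^sup>2 + (f (k + 3) - f (k + 2))\<^sup>2 \<le> clamped_energy k (k + 3)"
    using xy by (simp add: clamp_def max_def min_def)
  moreover have "(d - a)\<^sup>2 \<le> (b - a)\<^sup>2 + (c - a)\<^sup>2 + (c - b)\<^sup>2 + (d - b)\<^sup>2 + (d - c)\<^sup>2"
    for a b c d :: real
  proof -
    \<comment> \<open>A balanced Wheatstone bridge: the deficit vanishes exactly for
      \<open>b = c = (a + d) / 2\<close>.\<close>
    have "0 \<le> (b - a - (d - c))\<^sup>2 + 2 * (c - b)\<^sup>2" by simp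
    also have "\<dots> = (b - a)\<^sup>2 + (c - a)\<^sup>2 + (c - b)\<^sup>2 + (d - b)\<^sup>2 + (d - c)\<^sup>2 - (d - a)\<^sup>2"
      by (simp add: power2_eq_square algebra_simps)
    finally show ?thesis by simp
  qed
  ultimately show ?thesis by (force simp: resistance_le_def intro: order_trans)
qed

text \<open>Four vertices between two bridges span at least 5 of their 6 pairs, by
  \<open>12 \<le> 2 * 5 + 1 + 1\<close>. Either \<open>k\<close> and \<open>k + 3\<close> are
  adjacent, or all other pairs are, and two paths of length 2 lie in parallel.\<close>

lemma isolated_block:
  assumes c: "card (cut k) = 1" "card (cut (k + 4)) = 1" and k: "k + 4 \<le> n"
  shows "resistance_le k (k + 3) 1"
proof -
  let ?P = "{(k, k + 1), (k, k + 2), (k + 1, k + 2), (k + 1, k + 3), (k + 2, k + 3)}"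
  have e: "card (inner_edges k (k + 4)) \<ge> 5"
    using handshake_block[of k "k + 4"] c k by simp
  show ?thesis
  proof (cases "(k, k + 3) \<in> R")
    case True
    then show ?thesis
      using clamped_energy_ge[of "{(k, k + 3)}" k "k + 3"]
      by (simp add: resistance_le_def edges_def clamp_def)
  next
    case False
    have "inner_edges k (k + 4) \<subseteq> ?P"
    proof
      fix e assume "e \<in> inner_edges k (k + 4)"
      then obtain a b where ab: "e = (a, b)" "(a, b) \<in> R" "k \<le> a" "a < b" "b < k + 4"
        by (auto simp: inner_edges_def)
      then have "a = k \<and> b = k + 1 \<or> a = k \<and> b = k + 2 \<or> a = k \<and> b = k + 3 \<or> a = k + 1 \<and> b = k + 2 \<or>
          a = k + 1 \<and> b = k + 3 \<or> a = k + 2 \<and> b = k + 3"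
        by linarith
      then show "e \<in> ?P" using ab False by auto
    qed
    moreover have "card ?P = 5" by simp
    ultimately have eq: "inner_edges k (k + 4) = ?P"
      using e by (intro card_seteq) auto
    have "?P \<subseteq> edges"
      unfolding eq[symmetric] by (auto simp: inner_edges_def edges_def)
    then have "{(k, k + 1), (k, k + 2), (k + 1, k + 3), (k + 2, k + 3)} \<subseteq> edges"
      by simp
    from clamped_energy_ge[OF this, of k "k + 3"]
    have "(f (k + 1) - f k)\<^sup>2 + (f (k + 2) - f k)\<^sup>2
      + (f (k + 3) - f (k + 1))\<^sup>2 + (f (k + 3) - f (k + 2))\<^sup>2 \<le> clamped_energy k (k + 3)"
      by (simp add: clamp_def max_def min_def)
    moreover have "(d - a)\<^sup>2 \<le> (b - a)\<^sup>2 + (c - a)\<^sup>2 + (d - b)\<^sup>2 + (d - c)\<^sup>2"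
      for a b c d :: real
    proof -
      have "0 \<le> ((b - a - (d - b))\<^sup>2 + (c - a - (d - c))\<^sup>2) / 2" by simp
      also have "\<dots> = (b - a)\<^sup>2 + (c - a)\<^sup>2 + (d - b)\<^sup>2 + (d - c)\<^sup>2 - (d - a)\<^sup>2"
        by (simp add: power2_eq_square field_simps)
      finally show ?thesis by simp
    qed
    ultimately show ?thesis by (force simp: resistance_le_def intro: order_trans)
  qed
qed

text \<open>Three consecutive cuts after a bridge cost at most 1 if the bridge is followed by a triangle
  or if the next bridge comes after four vertices. Otherwise one of the two even cuts has at least
  four edges, and \<open>1 + 1/4 + 1/2 + 1/3 + 1/3 + 1/2 \<le> 3\<close>.\<close>

lemma segment_exists:
  assumes p: "even p" "p + 6 < n"
  shows "\<exists>len\<in>{2, 4, 6}. resistance_le p (p + len) (len / 2)"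
proof (cases "card (cut (p + 1)) = 1")
  case False
  then have "card (cut (p + 1)) \<ge> 3" using p by (intro cut_odd_ge) auto
  then have "resistance_le p (p + 1) (1 / 3)" using resistance_le_Suc[of 3 p] by simp
  moreover have "card (cut (p + 2)) \<ge> 2" using p by (intro cut_even_ge) auto
  then have "resistance_le (p + 1) (p + 2) (1 / 2)" using resistance_le_Suc[of 2 "p + 1"] by simp
  ultimately have "resistance_le p (p + 2) (1 / 3 + 1 / 2)"
    by (rule resistance_le_series) (use p in auto)
  then have "resistance_le p (p + 2) 1" by (rule resistance_le_mono) simp
  then show ?thesis by auto
next
  case c1: True
  have unit: "resistance_le (p + i) (p + (i + 1)) (1 / real m)"
    if "m \<le> card (cut (p + (i + 1)))" "m > 0" for i m
    using resistance_le_Suc[of m "p + i"] that by simp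
  have r1: "resistance_le p (p + 1) 1" using resistance_le_Suc[of 1 p] c1 by simp
  have four: ?thesis if "resistance_le (p + 1) (p + 4) 1"
  proof -
    have "resistance_le p (p + 4) (1 + 1)"
      by (rule resistance_le_series[OF r1 that]) (use p in auto)
    then show ?thesis by auto
  qed
  have c2: "card (cut (p + 2)) \<ge> 2" and c4: "card (cut (p + 4)) \<ge> 2" and c6: "card (cut (p + 6)) \<ge> 2"
    using p by (auto intro!: cut_even_ge)
  have c3: "card (cut (p + 3)) \<ge> 3"
    using cut_two_after_bridge[of "p + 1"] c1 p by (simp add: numeral_3_eq_3)
  consider (tri) "card (cut (p + 2)) = 2" "card (cut (p + 4)) = 2" | (block) "card (cut (p + 5)) = 1"
    | (wide) "card (cut (p + 5)) \<noteq> 1" "card (cut (p + 2)) \<noteq> 2 \<or> card (cut (p + 4)) \<noteq> 2"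
    by blast
  then show ?thesis
  proof cases
    case tri
    then have "resistance_le (p + 1) (p + 4) 1"
      using triangle_block[of "p + 1"] c1 p by (simp add: add.commute)
    then show ?thesis by (rule four)
  next
    case block
    then have "resistance_le (p + 1) (p + 4) 1"
      using isolated_block[of "p + 1"] c1 p by (simp add: add.commute)
    then show ?thesis by (rule four)
  next
    case wide
    have c5: "card (cut (p + 5)) \<ge> 3" using wide p by (intro cut_odd_ge) auto
    obtain m2 m4 :: nat where m: "m2 \<le> card (cut (p + 2))" "m4 \<le> card (cut (p + 4))" "m2 > 0" "m4 > 0"
      "1 / real m2 + 1 / real m4 \<le> 3 / 4"
    proof (cases "card (cut (p + 2)) = 2")
      case True
      then have "card (cut (p + 4)) \<ge> 4" using wide p by (intro cut_even_ge4) auto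
      then show ?thesis using c2 by (intro that[of 2 4]) auto
    next
      case False
      then have "card (cut (p + 2)) \<ge> 4" using wide p by (intro cut_even_ge4) auto
      then show ?thesis using c4 by (intro that[of 4 2]) auto
    qed
    have "resistance_le p (p + 2) (1 + 1 / m2)"
      by (rule resistance_le_series[OF r1]) (use unit[of m2 1] m p in auto)
    then have "resistance_le p (p + 3) (1 + 1 / m2 + 1 / 3)"
      by (rule resistance_le_series) (use unit[of 3 2] c3 p in auto)
    then have "resistance_le p (p + 4) (1 + 1 / m2 + 1 / 3 + 1 / m4)"
      by (rule resistance_le_series) (use unit[of m4 3] m p in auto)
    then have "resistance_le p (p + 5) (1 + 1 / m2 + 1 / 3 + 1 / m4 + 1 / 3)"
      by (rule resistance_le_series) (use unit[of 3 4] c5 p in auto)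
    then have "resistance_le p (p + 6) (1 + 1 / m2 + 1 / 3 + 1 / m4 + 1 / 3 + 1 / 2)"
      by (rule resistance_le_series) (use unit[of 2 5] c6 p in auto)
    then have "resistance_le p (p + 6) 3"
      by (rule resistance_le_mono) (use m(5) in simp)
    then show ?thesis by auto
  qed
qed

text \<open>This is for the at most five gaps left over at the right end, where
  \<open>segment_exists\<close> does not reach.\<close>

lemma resistance_le_trivial:
  assumes "p \<le> q" "q < n"
  shows "resistance_le p q (real (q - p))"
  using assms
proof (induction q rule: dec_induct)
  case base
  then show ?case by (simp add: resistance_le_def)
next
  case (step q)
  have "resistance_le q (Suc q) 1"
    using resistance_le_Suc[of 1 q] cut_pos[of "Suc q"] step by simp
  then have "resistance_le p (Suc q) (real (q - p) + 1)"
    using step by (intro resistance_le_series[OF step.IH]) auto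
  then show ?case using step.hyps by (simp add: of_nat_diff algebra_simps)
qed

text \<open>Replacing \<open>f\<close> by its linear interpolation along the segments halves the energy: the
  segments have at most half of the resistance of a path.\<close>

lemma interpolation:
  assumes "even p" "p < n"
  shows "\<exists>h. h p = f p \<and> (\<Sum>j=p..<n - 1. (h (Suc j) - h j)\<^sup>2) \<le> clamped_energy p (n - 1) / 2 \<and>
    (\<Sum>j=p..<n. (h j - f j)\<^sup>2) \<le> 64 * clamped_energy p (n - 1)"
  using assms
proof (induction "n - p" arbitrary: p rule: less_induct)
  case less
  show ?case
  proof (cases "p + 6 < n")
    case False
    have "(f p - f j)\<^sup>2 \<le> 5 * clamped_energy p (n - 1)" if j: "j \<in> {p..<n}" for j
    proof -
      have "(f p - f j)\<^sup>2 \<le> (f p - f (n - 1))\<^sup>2"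
      proof -
        have "f p \<le> f j" "f j \<le> f (n - 1)" using j by (auto intro!: f_mono)
        then show ?thesis by (simp flip: abs_le_square_iff)
      qed
      also have "\<dots> \<le> real (n - 1 - p) * clamped_energy p (n - 1)"
        using resistance_le_trivial[of p "n - 1"] less.prems
        by (simp add: resistance_le_def power2_commute)
      also have "\<dots> \<le> 5 * clamped_energy p (n - 1)"
        using False less.prems clamped_energy_nonneg by (intro mult_right_mono) auto
      finally show ?thesis .
    qed
    \<comment> \<open>On the remaining at most 6 vertices \<open>h\<close> is constant, which costs
      the factor 6 * 5 = 30; a full segment costs at most 6 * 3 = 18. The common bound 64 has the
      integral root 8 that appears in \<open>energy_lower_bound\<close>.\<close>
    then have "(\<Sum>j=p..<n. (f p - f j)\<^sup>2) \<le> real (card {p..<n}) * (5 * clamped_energy p (n - 1))"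
      by (rule sum_bounded_above)
    also have "\<dots> \<le> 6 * (5 * clamped_energy p (n - 1))"
      using False clamped_energy_nonneg by (intro mult_right_mono) auto
    also have "\<dots> \<le> 64 * clamped_energy p (n - 1)" using clamped_energy_nonneg[of p] by simp
    finally show ?thesis
      using clamped_energy_nonneg[of p] by (intro exI[of _ "\<lambda>_. f p"]) simp
  next
    case True
    then obtain len where len: "len \<in> {2, 4, 6}" "resistance_le p (p + len) (len / 2)"
      using segment_exists less.prems by blast
    define q where "q = p + len"
    define d where "d = f q - f p"
    have q: "p < q" "q < n" "even q" using len(1) True less.prems by (auto simp: q_def)
    have "n - q < n - p" using q by linarith
    from less.hyps[OF this q(3,2)] obtain h where h: "h q = f q"
      "(\<Sum>j=q..<n - 1. (h (Suc j) - h j)\<^sup>2) \<le> clamped_energy q (n - 1) / 2"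
      "(\<Sum>j=q..<n. (h j - f j)\<^sup>2) \<le> 64 * clamped_energy q (n - 1)"
      by blast
    have len0: "real len > 0" "real len \<le> 6" using len(1) by auto
    have d: "d\<^sup>2 \<le> len / 2 * clamped_energy p q"
      using len(2) by (simp add: resistance_le_def d_def q_def)
    have add: "clamped_energy p q + clamped_energy q (n - 1) \<le> clamped_energy p (n - 1)"
      using q by (intro clamped_energy_add) auto
    define g where "g = (\<lambda>j. if j < q then f p + real (j - p) / len * d else h j)"
    \<comment> \<open>Valid at \<open>j = q\<close> as well because \<open>h q = f q\<close>; the
      increment from \<open>q - 1\<close> to \<open>q\<close> depends on it.\<close>
    have g: "g j = f p + real (j - p) / len * d" if "p \<le> j" "j \<le> q" for j
      using that h(1) len0 by (auto simp: g_def d_def q_def)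
    have split: "(\<Sum>j=p..<m. F j) = (\<Sum>j=p..<q. F j) + (\<Sum>j=q..<m. F j)" if "q \<le> m" for m and F :: "nat \<Rightarrow> real"
      using sum.atLeastLessThan_concat[of p q m F] that q by simp
    have "(\<Sum>j=p..<q. (g (Suc j) - g j)\<^sup>2) = (\<Sum>j=p..<q. (d / len)\<^sup>2)"
    proof (rule sum.cong)
      fix j assume "j \<in> {p..<q}"
      then have "g (Suc j) - g j = d / len"
        by (simp add: g Suc_diff_le add_divide_distrib distrib_right)
      then show "(g (Suc j) - g j)\<^sup>2 = (d / len)\<^sup>2" by simp
    qed simp
    also have "\<dots> = d\<^sup>2 / len"
      using len0 by (simp add: q_def power2_eq_square)
    also have "\<dots> \<le> clamped_energy p q / 2"
      using d len0 by (simp add: field_simps)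
    finally have e1: "(\<Sum>j=p..<q. (g (Suc j) - g j)\<^sup>2) \<le> clamped_energy p q / 2" .
    have e2: "(\<Sum>j=q..<n - 1. (g (Suc j) - g j)\<^sup>2) = (\<Sum>j=q..<n - 1. (h (Suc j) - h j)\<^sup>2)"
      by (rule sum.cong) (auto simp: g_def)
    have close: "(g j - f j)\<^sup>2 \<le> d\<^sup>2" if j: "j \<in> {p..<q}" for j
    proof -
      have d0: "d \<ge> 0" using f_mono[of p q] q by (simp add: d_def)
      have le1: "real (j - p) / len \<le> 1" using j len0 by (auto simp: q_def)
      define t where "t = real (j - p) / len * d"
      have "t \<le> 1 * d" unfolding t_def using d0 le1 by (intro mult_right_mono)
      moreover have "t \<ge> 0" using d0 by (simp add: t_def)
      moreover have "f p \<le> f j" "f j \<le> f q" using j q by (auto intro!: f_mono)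
      moreover have "g j = f p + t" unfolding t_def using j by (intro g) auto
      moreover have "d = f q - f p" by (rule d_def)
      ultimately have "\<bar>g j - f j\<bar> \<le> \<bar>d\<bar>" by linarith
      then show ?thesis by (simp add: abs_le_square_iff)
    qed
    have "(\<Sum>j=p..<q. (g j - f j)\<^sup>2) \<le> real (card {p..<q}) * d\<^sup>2"
      using close by (rule sum_bounded_above)
    also have "\<dots> = len * d\<^sup>2" by (simp add: q_def)
    also have "\<dots> \<le> 6 * (len / 2 * clamped_energy p q)"
      using len0 d by (intro mult_mono) auto
    also have "\<dots> \<le> 64 * clamped_energy p q"
      using len0 mult_right_mono[OF len0(2) clamped_energy_nonneg[of p q]] clamped_energy_nonneg[of p q] by simp
    finally have e3: "(\<Sum>j=p..<q. (g j - f j)\<^sup>2) \<le> 64 * clamped_energy p q" .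
    have e4: "(\<Sum>j=q..<n. (g j - f j)\<^sup>2) = (\<Sum>j=q..<n. (h j - f j)\<^sup>2)"
      by (rule sum.cong) (auto simp: g_def)
    have "g p = f p" using g[of p] q by simp
    moreover have "(\<Sum>j=p..<n - 1. (g (Suc j) - g j)\<^sup>2) \<le> clamped_energy p (n - 1) / 2"
      using q e1 e2 h(2) add by (subst split) auto
    moreover have "(\<Sum>j=p..<n. (g j - f j)\<^sup>2) \<le> 64 * clamped_energy p (n - 1)"
      using q e3 e4 h(3) add by (subst split) auto
    ultimately show ?thesis by blast
  qed
qed

text \<open>Minkowski for \<open>f = (h - \<mu>) + (f - h + \<mu>)\<close>: the first part obeys the
  Poincare inequality of the path, the second is the interpolation error. The first constant grows
  like n / (pi sqrt 2), so 8 is of lower order.\<close>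

lemma energy_lower_bound:
  assumes n2: "n \<ge> 2" and mean: "(\<Sum>i<n. f i) = 0"
  shows "sqrt (\<Sum>i<n. (f i)\<^sup>2) \<le>
    sqrt (\<Sum>(i, j)\<in>edges. (f j - f i)\<^sup>2) * (1 / sqrt (2 * (2 - 2 * cos (pi / n))) + 8)"
proof -
  define E where "E = (\<Sum>(i, j)\<in>edges. (f j - f i)\<^sup>2)"
  have "clamp 0 (n - 1) i = i" if "i < n" for i
    using that by (simp add: clamp_def)
  then have "clamped_energy 0 (n - 1) = E"
    unfolding clamped_energy_def E_def
    by (intro sum.cong) (auto simp: edges_def dest: R_less)
  then obtain h where h: "(\<Sum>j=0..<n - 1. (h (Suc j) - h j)\<^sup>2) \<le> E / 2"
    "(\<Sum>j=0..<n. (h j - f j)\<^sup>2) \<le> 64 * E"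
    using interpolation[of 0] n2 by auto
  define \<mu> where "\<mu> = (\<Sum>i<n. h i) / n"
  have centred: "(\<Sum>i<n. h i - \<mu>) = 0"
    using n2 by (simp add: \<mu>_def sum_subtractf)
  have "cos (pi / n) < cos 0"
    using n2 by (intro cos_monotone_0_pi) (auto simp: field_simps)
  then have lam: "2 - 2 * cos (pi / n) > 0" by simp
  have "(2 - 2 * cos (pi / n)) * (\<Sum>i<n. (h i - \<mu>)\<^sup>2) \<le> E / 2"
    using path_poincare[OF n2 centred] h(1) by (simp add: lessThan_atLeast0)
  then have "(\<Sum>i<n. (h i - \<mu>)\<^sup>2) \<le> E / (2 * (2 - 2 * cos (pi / n)))"
    using lam by (simp add: field_simps)
  then have "L2_set (\<lambda>i. h i - \<mu>) {..<n} \<le> sqrt (E / (2 * (2 - 2 * cos (pi / n))))"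
    unfolding L2_set_def by (rule real_sqrt_le_mono)
  then have A: "L2_set (\<lambda>i. h i - \<mu>) {..<n} \<le> sqrt E * (1 / sqrt (2 * (2 - 2 * cos (pi / n))))"
    by (simp only: real_sqrt_divide mult_1_right times_divide_eq_right)
  \<comment> \<open>As \<open>f\<close> has mean 0, adding \<open>\<mu>\<close> centres
    \<open>f - h\<close>, which can only shrink its norm.\<close>
  have diff: "(\<Sum>i<n. f i - h i) = - (n * \<mu>)"
    using n2 by (simp add: \<mu>_def sum_subtractf mean)
  have "(\<Sum>i<n. (f i - h i + \<mu>)\<^sup>2) =
      (\<Sum>i<n. (f i - h i)\<^sup>2 + 2 * \<mu> * (f i - h i) + \<mu>\<^sup>2)"
    by (rule sum.cong) (simp_all add: power2_eq_square algebra_simps)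
  also have "\<dots> = (\<Sum>i<n. (f i - h i)\<^sup>2) - n * \<mu>\<^sup>2"
    unfolding sum.distrib sum_distrib_left[symmetric] diff by (simp add: power2_eq_square)
  finally have "(\<Sum>i<n. (f i - h i + \<mu>)\<^sup>2) = (\<Sum>i<n. (f i - h i)\<^sup>2) - n * \<mu>\<^sup>2" .
  also have "\<dots> \<le> 64 * E"
  proof -
    have "(\<Sum>i<n. (f i - h i)\<^sup>2) \<le> 64 * E"
      using h(2) by (simp add: lessThan_atLeast0 power2_commute[of "f _"])
    moreover have "n * \<mu>\<^sup>2 \<ge> 0" by simp
    ultimately show ?thesis by linarith
  qed
  finally have "L2_set (\<lambda>i. f i - h i + \<mu>) {..<n} \<le> sqrt (64 * E)"
    unfolding L2_set_def by (rule real_sqrt_le_mono)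
  also have "\<dots> = sqrt E * 8" by (simp add: real_sqrt_mult)
  finally have B: "L2_set (\<lambda>i. f i - h i + \<mu>) {..<n} \<le> sqrt E * 8" .
  have "sqrt (\<Sum>i<n. (f i)\<^sup>2) = L2_set (\<lambda>i. (h i - \<mu>) + (f i - h i + \<mu>)) {..<n}"
    by (simp add: L2_set_def)
  also have "\<dots> \<le> L2_set (\<lambda>i. h i - \<mu>) {..<n} + L2_set (\<lambda>i. f i - h i + \<mu>) {..<n}"
    by (rule L2_set_triangle_ineq)
  finally show ?thesis
    using A B unfolding E_def[symmetric] by (simp add: distrib_left)
qed

end

section \<open>Chains of blocks joined by bridges\<close>

text \<open>The blocks are \<open>5 + 4 * i, \<dots>, 8 + 4 * i\<close>. The same pattern is continued at both ends, where
  the edges \<open>{2, 3}\<close> and \<open>{t, t + 1}\<close> are replaced by edges to the leftover vertices; the right end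
  has 5 or 7 vertices depending on \<open>n mod 4\<close>.\<close>

definition chain_up :: "nat \<Rightarrow> nat \<Rightarrow> nat \<Rightarrow> nat \<Rightarrow> bool" where
  "chain_up n t u v \<longleftrightarrow> u < v \<and> v < n \<and>
    (v = u + 1 \<and> u \<noteq> 2 \<and> u \<noteq> t \<or>
     v = u + 2 \<and> (u mod 4 = 1 \<or> u mod 4 = 2) \<or>
     u = 0 \<and> (v = 2 \<or> v = 3) \<or>
     u = t \<and> v = (if n = t + 4 then t + 3 else t + 4) \<or>
     u = t + 1 \<and> v = n - 1)"

definition chain_graph :: "nat \<Rightarrow> nat \<Rightarrow> nat pair_pre_digraph" where
  "chain_graph n t =
    \<lparr>pverts = {..<n}, parcs = {(u, v). chain_up n t u v \<or> chain_up n t v u}\<rparr>"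

lemma pair_graph_chain: "pair_graph (chain_graph n t)"
proof
  show "finite (parcs (chain_graph n t))"
    by (rule finite_subset[of _ "{..<n} \<times> {..<n}"]) (auto simp: chain_graph_def chain_up_def)
  show "symmetric (with_proj (chain_graph n t))"
    by (auto simp: symmetric_def sym_def chain_graph_def)
qed (auto simp: chain_graph_def chain_up_def)

text \<open>Solved for the upper endpoint, so that for a given \<open>u\<close> the neighbours below
  it can also be read off from conditions on \<open>u\<close>.\<close>

lemma chain_up_iff_upper:
  "chain_up n t v u \<longleftrightarrow> v < u \<and> u < n \<and>
    (u = v + 1 \<and> u \<noteq> 3 \<and> u \<noteq> t + 1 \<or>
     u = v + 2 \<and> (u mod 4 = 3 \<or> u mod 4 = 0) \<or>
     v = 0 \<and> (u = 2 \<or> u = 3) \<or>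
     v = t \<and> u = (if n = t + 4 then t + 3 else t + 4) \<or>
     v = t + 1 \<and> u = n - 1)"
proof -
  have "(v mod 4 = 1 \<or> v mod 4 = 2) = (u mod 4 = 3 \<or> u mod 4 = 0)" if "u = v + 2"
    using that by presburger
  then have "(u = v + 2 \<and> (v mod 4 = 1 \<or> v mod 4 = 2)) = (u = v + 2 \<and> (u mod 4 = 3 \<or> u mod 4 = 0))"
    by (rule conj_cong[OF refl])
  moreover have "(u = v + 1 \<and> v \<noteq> 2 \<and> v \<noteq> t) = (u = v + 1 \<and> u \<noteq> 3 \<and> u \<noteq> t + 1)"
    by auto
  ultimately show ?thesis
    unfolding chain_up_def by (simp only:)
qed

lemma chain_nbrs:
  assumes t: "t mod 4 = 2" "t \<ge> 6" and n: "n = t + 4 \<or> n = t + 6" and u: "u < n"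
  shows "\<exists>x y z. x \<noteq> y \<and> x \<noteq> z \<and> y \<noteq> z \<and>
    (\<forall>v. chain_up n t u v \<or> chain_up n t v u \<longleftrightarrow> v = x \<or> v = y \<or> v = z)"
proof -
  \<comment> \<open>Writing \<open>t\<close> and later \<open>u\<close> as sums avoids truncated
    subtraction; the residues mod 4 are then constants.\<close>
  obtain r where r: "t = r + 6" using t(2) by (metis le_add_diff_inverse2)
  have r4: "r mod 4 = 0" using t(1) unfolding r by presburger
  have mods: "(r + 6) mod 4 = 2" "(r + 7) mod 4 = 3" "(r + 8) mod 4 = 0" "(r + 9) mod 4 = 1"
    "(r + 10) mod 4 = 2" "(r + 11) mod 4 = 3"
    "(6 + r) mod 4 = 2" "(7 + r) mod 4 = 3" "(8 + r) mod 4 = 0" "(9 + r) mod 4 = 1"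
    "(10 + r) mod 4 = 2" "(11 + r) mod 4 = 3"
    using r4 by presburger+
  have P: ?thesis if "x \<noteq> y" "x \<noteq> z" "y \<noteq> z"
    "\<And>v. chain_up n t u v \<Longrightarrow> v = x \<or> v = y \<or> v = z"
    "\<And>v. chain_up n t v u \<Longrightarrow> v = x \<or> v = y \<or> v = z"
    "chain_up n t u x \<or> chain_up n t x u" "chain_up n t u y \<or> chain_up n t y u"
    "chain_up n t u z \<or> chain_up n t z u" for x y z
    using that by blast
  consider "u = 0" | "u = 1" | "u = 2" | "u = 3" | "4 \<le> u" "u < t" | "t \<le> u"
    by linarith
  then show ?thesis
  proof cases
    case 1
    show ?thesis
      by (rule P[of 1 2 3]; (unfold chain_up_iff_upper[of n t _ u])?; (unfold chain_up_def)?) (use 1 n in \<open>auto simp: r\<close>)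
  next
    case 2
    show ?thesis
      by (rule P[of 0 2 3]; (unfold chain_up_iff_upper[of n t _ u])?; (unfold chain_up_def)?) (use 2 n in \<open>auto simp: r\<close>)
  next
    case 3
    show ?thesis
      by (rule P[of 0 1 4]; (unfold chain_up_iff_upper[of n t _ u])?; (unfold chain_up_def)?) (use 3 n in \<open>auto simp: r\<close>)
  next
    case 4
    show ?thesis
      by (rule P[of 0 1 4]; (unfold chain_up_iff_upper[of n t _ u])?; (unfold chain_up_def)?) (use 4 n in \<open>auto simp: r\<close>)
  next
    case 5
    obtain w where w: "u = w + 4" using 5(1) by (metis le_add_diff_inverse2)
    have w1: "w < r + 2" using 5(2) by (simp add: w r)
    have "w mod 4 = 0 \<or> w mod 4 = 1 \<or> w mod 4 = 2 \<or> w mod 4 = 3" by presburger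
    then consider "w mod 4 = 1 \<or> w mod 4 = 2" | "w mod 4 = 3 \<or> w mod 4 = 0" by metis
    then show ?thesis
    proof cases
      case 1
      show ?thesis
        by (rule P[of "w + 3" "w + 5" "w + 6"]; (unfold chain_up_iff_upper[of n t _ u])?; (unfold chain_up_def)?; (unfold w r)?) (use 1 n w1 in \<open>auto simp: r\<close>)
    next
      case 2
      show ?thesis
        by (rule P[of "w + 2" "w + 3" "w + 5"]; (unfold chain_up_iff_upper[of n t _ u])?; (unfold chain_up_def)?; (unfold w r)?) (use 2 n w1 in \<open>auto simp: r\<close>)
    qed
  next
    case 6
    then consider "u = t" | "u = t + 1" | "u = t + 2" | "u = t + 3" "n = t + 4" | "u = t + 3" "n = t + 6"
      | "u = t + 4" "n = t + 6" | "u = t + 5" "n = t + 6"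
      using n u by linarith
    then show ?thesis
    proof cases
      case 1
      show ?thesis
        by (rule P[of "r + 5" "r + 8" "if n = t + 4 then r + 9 else r + 10"]; (unfold chain_up_iff_upper[of n t _ u])?; (unfold chain_up_def)?; (unfold 1 r)?)
          (use n in \<open>auto simp: r mods\<close>)
    next
      case 2
      show ?thesis
        by (rule P[of "r + 5" "r + 8" "n - 1"]; (unfold chain_up_iff_upper[of n t _ u])?; (unfold chain_up_def)?; (unfold 2 r)?) (use n in \<open>auto simp: r mods\<close>)
    next
      case 3
      show ?thesis
        by (rule P[of "r + 6" "r + 7" "r + 9"]; (unfold chain_up_iff_upper[of n t _ u])?; (unfold chain_up_def)?; (unfold 3 r)?) (use n in \<open>auto simp: r mods\<close>)
    next
      case 4
      show ?thesis
        by (rule P[of "r + 6" "r + 7" "r + 8"]; (unfold chain_up_iff_upper[of n t _ u])?; (unfold chain_up_def)?; (unfold 4 r)?) (auto simp: mods)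
    next
      case 5
      show ?thesis
        by (rule P[of "r + 8" "r + 10" "r + 11"]; (unfold chain_up_iff_upper[of n t _ u])?; (unfold chain_up_def)?; (unfold 5 r)?) (auto simp: mods)
    next
      case 6
      show ?thesis
        by (rule P[of "r + 6" "r + 9" "r + 11"]; (unfold chain_up_iff_upper[of n t _ u])?; (unfold chain_up_def)?; (unfold 6 r)?) (auto simp: mods)
    next
      case 7
      show ?thesis
        by (rule P[of "r + 7" "r + 9" "r + 10"]; (unfold chain_up_iff_upper[of n t _ u])?; (unfold chain_up_def)?; (unfold 7 r)?) (auto simp: mods)
    qed
  qed
qed

text \<open>Connectedness follows by descent to vertex 0. The predecessor serves except at 3 and
  \<open>t + 1\<close>, whose edge to it was removed; there 0 and \<open>t - 1\<close> step
  in.\<close>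

lemma chain_lower_nbr:
  assumes t: "t mod 4 = 2" "t \<ge> 6" and v: "0 < v" "v < n"
  shows "\<exists>u<v. chain_up n t u v"
proof -
  consider "v = 3" | "v = t + 1" | "v \<noteq> 3" "v \<noteq> t + 1" by blast
  then show ?thesis
  proof cases
    case 1
    then show ?thesis using v by (intro exI[of _ 0]) (auto simp: chain_up_def)
  next
    case 2
    obtain s where s: "t = s + 1" using t(2) by (metis add.commute le_add_diff_inverse le_trans one_le_numeral)
    have "s mod 4 = 1" using t(1) unfolding s by presburger
    then have "chain_up n t s v" using 2 v by (simp add: chain_up_def s)
    then show ?thesis using 2 s by (intro exI[of _ s]) auto
  next
    case 3
    then show ?thesis using v by (intro exI[of _ "v - 1"]) (auto simp: chain_up_def)
  qed
qed

lemma chain_graph_cubic: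
  assumes t: "t mod 4 = 2" "t \<ge> 6" and n: "n = t + 4 \<or> n = t + 6"
  shows "chain_graph n t \<in> connected_cubic_graphs n"
proof -
  let ?G = "chain_graph n t"
  interpret pair_graph ?G by (rule pair_graph_chain)
  have verts: "pverts ?G = {..<n}" by (simp add: chain_graph_def)
  have n0: "0 < n" using n by auto
  have reach: "v < n \<Longrightarrow> (0, v) \<in> rtrancl_on {..<n} ((parcs ?G)\<^sup>s)
      \<and> (v, 0) \<in> rtrancl_on {..<n} ((parcs ?G)\<^sup>s)" for v
  proof (induction v rule: less_induct)
    case (less v)
    show ?case
    proof (cases "v = 0")
      case True
      then show ?thesis using n0 by (auto intro: rtrancl_on_refl)
    next
      case False
      then obtain u where u: "u < v" "chain_up n t u v"
        using chain_lower_nbr t less.prems by blast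
      then have arcs: "(u, v) \<in> (parcs ?G)\<^sup>s" "(v, u) \<in> (parcs ?G)\<^sup>s"
        by (auto simp: symcl_def chain_graph_def)
      then show ?thesis
        using less.IH[OF u(1)] less.prems u(1)
        by (auto intro: rtrancl_on_into_rtrancl_on converse_rtrancl_on_into_rtrancl_on)
    qed
  qed
  have "Digraph_Component.connected (with_proj ?G)"
    using n0 reach by (auto simp: connected_conv verts intro: rtrancl_on_trans)
  moreover have "out_degree (with_proj ?G) u = 3" if u: "u < n" for u
  proof -
    obtain x y z where xyz: "x \<noteq> y" "x \<noteq> z" "y \<noteq> z"
      "\<And>v. chain_up n t u v \<or> chain_up n t v u \<longleftrightarrow> v = x \<or> v = y \<or> v = z"
      using chain_nbrs[OF assms u] by blast
    have "{v. (u, v) \<in> parcs ?G} = {x, y, z}"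
      using xyz(4) by (auto simp: chain_graph_def)
    then show ?thesis using xyz by (simp add: out_degree_with_proj)
  qed
  ultimately show ?thesis
    using pair_graph_chain by (simp add: connected_cubic_graphs_def verts)
qed

section \<open>A test function on the chain\<close>

text \<open>The factor \<open>2 * sin (d / 2)\<close> makes the sum telescope.\<close>

lemma sum_cos_arith:
  "2 * sin (d / 2) * (\<Sum>j<N. cos (a + real j * d)) = sin (a + (real N - 1 / 2) * d) - sin (a - d / 2)"
proof (induction N)
  case 0
  then show ?case by (simp add: field_simps)
next
  case (Suc N)
  define x where "x = a + real N * d"
  have "2 * sin (d / 2) * cos x = sin (x + d / 2) - sin (x - d / 2)"
    by (simp add: sin_add sin_diff)
  moreover have "x - d / 2 = a + (real N - 1 / 2) * d" "x + d / 2 = a + (real (Suc N) - 1 / 2) * d"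
    by (simp_all add: x_def field_simps)
  ultimately show ?case using Suc by (simp add: distrib_left flip: x_def)
qed

text \<open>First nonconstant Neumann eigenvector of the path on \<open>N\<close> vertices; the half
  shift makes it symmetric about the point between \<open>N - 1\<close> and
  \<open>N\<close>.\<close>

definition path_eigvec :: "nat \<Rightarrow> nat \<Rightarrow> real" where
  "path_eigvec N j = cos (pi * (real j + 1 / 2) / N)"

lemma sum_path_eigvec:
  assumes "N \<ge> 1"
  shows "(\<Sum>j<N. path_eigvec N j) = 0"
proof -
  have "sin (pi / N / 2) > 0" using assms by (intro sin_gt_zero) (auto simp: field_simps)
  moreover have "2 * sin (pi / N / 2) * (\<Sum>j<N. cos (pi / (2 * N) + real j * (pi / N))) = 0"
    unfolding sum_cos_arith using assms by (simp add: field_simps)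
  moreover have "path_eigvec N j = cos (pi / (2 * N) + real j * (pi / N))" for j
    using assms by (simp add: path_eigvec_def field_simps)
  ultimately show ?thesis by simp
qed

lemma sum_cos_full_period:
  assumes "N \<ge> 2"
  shows "(\<Sum>j<N. cos (a + real j * (2 * pi / N))) = 0"
proof -
  have "sin (2 * pi / N / 2) > 0" using assms by (intro sin_gt_zero) (auto simp: field_simps)
  moreover have "a + (real N - 1 / 2) * (2 * pi / N) = a - 2 * pi / N / 2 + 2 * pi"
    using assms by (simp add: field_simps)
  then have "2 * sin (2 * pi / N / 2) * (\<Sum>j<N. cos (a + real j * (2 * pi / N))) = 0"
    unfolding sum_cos_arith by (simp only: sin_periodic)
  ultimately show ?thesis by simp
qed

lemma sum_path_eigvec_sq:
  assumes "N \<ge> 2"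
  shows "(\<Sum>j<N. (path_eigvec N j)\<^sup>2) = N / 2"
proof -
  have eq: "(path_eigvec N j)\<^sup>2 = 1 / 2 + cos (pi / N + real j * (2 * pi / N)) / 2" for j
  proof -
    have "pi / N + real j * (2 * pi / N) = 2 * (pi * (real j + 1 / 2) / N)"
      using assms by (simp add: field_simps)
    then show ?thesis unfolding path_eigvec_def by (simp only: cos_double_cos) (simp add: diff_divide_distrib)
  qed
  show ?thesis
    unfolding eq sum.distrib sum_divide_distrib[symmetric] sum_cos_full_period[OF assms] by simp
qed

text \<open>The term \<open>j = N - 1\<close> is 0 by \<open>path_eigvec_end\<close>. Including it
  lets the squared sines run over a full period; the exact value \<open>2 * s^2 * N\<close> is then
  bounded by |sin x| \<le> |x|.\<close>

lemma path_eigvec_energy: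
  assumes "N \<ge> 2"
  shows "(\<Sum>j<N. (path_eigvec N (Suc j) - path_eigvec N j)\<^sup>2) \<le> pi\<^sup>2 / (2 * N)"
proof -
  define s where "s = sin (pi / (2 * N))"
  have eq: "(path_eigvec N (Suc j) - path_eigvec N j)\<^sup>2 =
      2 * s\<^sup>2 * (1 - cos (2 * pi / N + real j * (2 * pi / N)))" for j
  proof -
    have "path_eigvec N (Suc j) - path_eigvec N j = 2 * sin (pi * (real j + 1) / N) * sin (- (pi / (2 * N)))"
      unfolding path_eigvec_def cos_diff_cos
      by (rule arg_cong2[where f = "\<lambda>x y. 2 * sin x * sin y"]) (use assms in \<open>simp_all add: field_simps\<close>)
    then have "(path_eigvec N (Suc j) - path_eigvec N j)\<^sup>2 = 4 * s\<^sup>2 * (sin (pi * (real j + 1) / N))\<^sup>2"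
      by (simp add: s_def power_mult_distrib)
    moreover have "2 * pi / N + real j * (2 * pi / N) = 2 * (pi * (real j + 1) / N)"
      using assms by (simp add: field_simps)
    ultimately show ?thesis by (simp only: cos_double_sin) simp
  qed
  have "(\<Sum>j<N. (path_eigvec N (Suc j) - path_eigvec N j)\<^sup>2) = 2 * s\<^sup>2 * N"
    unfolding eq sum_distrib_left[symmetric] sum_subtractf sum_cos_full_period[OF assms] by simp
  also have "\<dots> \<le> 2 * (pi / (2 * N))\<^sup>2 * N"
  proof -
    have "\<bar>s\<bar> \<le> \<bar>pi / (2 * N)\<bar>" unfolding s_def by (rule abs_sin_x_le_abs_x)
    then have "s\<^sup>2 \<le> (pi / (2 * N))\<^sup>2" by (rule abs_le_square_iff[THEN iffD1])
    then show ?thesis by (intro mult_right_mono mult_left_mono) auto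
  qed
  also have "\<dots> = pi\<^sup>2 / (2 * N)" using assms by (simp add: power2_eq_square field_simps)
  finally show ?thesis .
qed

lemma path_eigvec_end:
  assumes "N \<ge> 1"
  shows "path_eigvec N (N - 1) = path_eigvec N N"
proof -
  have "pi * (real (N - 1) + 1 / 2) / N = pi - pi / (2 * N)" "pi * (real N + 1 / 2) / N = pi + pi / (2 * N)"
    using assms by (simp_all add: field_simps of_nat_diff)
  then show ?thesis by (simp add: path_eigvec_def cos_diff cos_add)
qed

lemma abs_path_eigvec_le: "\<bar>path_eigvec N j\<bar> \<le> 1"
  by (simp add: path_eigvec_def)

text \<open>Each block \<open>5 + 4 * i, \<dots>, 8 + 4 * i\<close> and each bridge has resistance 1, so the chain of
  \<open>m\<close> blocks carries the first nonconstant eigenvector of the path on \<open>2 * m\<close> vertices.\<close>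

definition chain_test :: "nat \<Rightarrow> nat \<Rightarrow> real" where
  "chain_test m v = (let w = path_eigvec (2 * m); i = (v - 5) div 4; r = (v - 5) mod 4 in
    if v < 5 then w 0 else if 4 * m + 5 \<le> v then w (2 * m)
    else if r = 0 then w (2 * i) else if r = 3 then w (2 * i + 1) else (w (2 * i) + w (2 * i + 1)) / 2)"

lemma chain_test_block:
  assumes "i < m"
  shows "chain_test m (4 * i + 5) = path_eigvec (2 * m) (2 * i)"
    and "chain_test m (4 * i + 6) = (path_eigvec (2 * m) (2 * i) + path_eigvec (2 * m) (2 * i + 1)) / 2"
    and "chain_test m (4 * i + 7) = (path_eigvec (2 * m) (2 * i) + path_eigvec (2 * m) (2 * i + 1)) / 2"
    and "chain_test m (4 * i + 8) = path_eigvec (2 * m) (2 * i + 1)"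
proof -
  have "(4 * i + k) div 4 = i" "(4 * i + k) mod 4 = k" if "k < 4" for k
    using that by simp_all
  from this[of 0] this[of 1] this[of 2] this[of 3]
  show "chain_test m (4 * i + 5) = path_eigvec (2 * m) (2 * i)"
    and "chain_test m (4 * i + 6) = (path_eigvec (2 * m) (2 * i) + path_eigvec (2 * m) (2 * i + 1)) / 2"
    and "chain_test m (4 * i + 7) = (path_eigvec (2 * m) (2 * i) + path_eigvec (2 * m) (2 * i + 1)) / 2"
    and "chain_test m (4 * i + 8) = path_eigvec (2 * m) (2 * i + 1)"
    using assms by (simp_all add: chain_test_def Let_def)
qed

lemma chain_test_left:
  assumes "m \<ge> 1" "v \<le> 5"
  shows "chain_test m v = path_eigvec (2 * m) 0"
  using assms chain_test_block(1)[of 0 m] by (cases "v = 5") (auto simp: chain_test_def)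

text \<open>Already the last vertex \<open>4 * m + 4\<close> of the last block has the end value, by
  the reflection \<open>path_eigvec_end\<close>; so no edge from there on carries energy.\<close>

lemma chain_test_right:
  assumes "m \<ge> 1" "4 * m + 4 \<le> v"
  shows "chain_test m v = path_eigvec (2 * m) (2 * m)"
proof (cases "v = 4 * m + 4")
  case True
  then have "v = 4 * (m - 1) + 8" using assms by simp
  moreover have "2 * (m - 1) + 1 = 2 * m - 1" using assms by simp
  ultimately show ?thesis
    using chain_test_block(4)[of "m - 1" m] path_eigvec_end[of "2 * m"] assms by simp
next
  case False
  then show ?thesis using assms by (simp add: chain_test_def)
qed

lemma chain_test_next:
  assumes "i < m"
  shows "chain_test m (4 * i + 9) = path_eigvec (2 * m) (2 * i + 2)"
proof (cases "Suc i < m")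
  case True
  then show ?thesis using chain_test_block(1)[of "Suc i" m] by (simp add: add.commute)
next
  case False
  then have "m = Suc i" using assms by simp
  then show ?thesis using chain_test_right[of m "4 * i + 9"] by simp
qed

lemma sum_pairs: "(\<Sum>i<m. g (2 * i) + g (2 * i + 1)) = (\<Sum>j<2 * m. g j)" for g :: "nat \<Rightarrow> real"
  by (induction m) auto

lemma sum_quadruples:
  "(\<Sum>k<4 * m. g k) = (\<Sum>i<m. g (4 * i) + g (4 * i + 1) + g (4 * i + 2) + g (4 * i + 3))"
  for g :: "nat \<Rightarrow> real"
  by (induction m) (auto simp: numeral_eq_Suc)

lemma sum_chain_split:
  fixes g :: "nat \<Rightarrow> real"
  assumes "4 * m + 5 \<le> n"
  shows "(\<Sum>v<n. g v) = (\<Sum>v<5. g v)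
    + (\<Sum>i<m. g (4 * i + 5) + g (4 * i + 6) + g (4 * i + 7) + g (4 * i + 8)) + (\<Sum>v=4 * m + 5..<n. g v)"
proof -
  have "(\<Sum>v<n. g v) = (\<Sum>v<5. g v) + (\<Sum>v=5..<4 * m + 5. g v) + (\<Sum>v=4 * m + 5..<n. g v)"
    using assms by (simp add: lessThan_atLeast0 sum.atLeastLessThan_concat)
  also have "(\<Sum>v=5..<4 * m + 5. g v) = (\<Sum>k<4 * m. g (k + 5))"
    using sum.shift_bounds_nat_ivl[of g 0 5 "4 * m"] by (simp add: lessThan_atLeast0)
  finally show ?thesis
    unfolding sum_quadruples by (simp only: add.assoc) simp
qed

text \<open>The irregular edges lie where the test function is constant. A block with values a, (a +
  b) / 2 twice, and b has energy 4 ((b - a) / 2)^2 = (b - a)^2, one edge of the path; a bridge is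
  the next edge.\<close>

lemma chain_energy:
  assumes m: "m \<ge> 1" and t: "t = 4 * m + 6" and n: "n = t + 4 \<or> n = t + 6"
  shows "dirichlet (chain_graph n t) (chain_test m) (chain_test m) \<le>
    (\<Sum>j<2 * m. (path_eigvec (2 * m) (Suc j) - path_eigvec (2 * m) j)\<^sup>2)"
proof -
  define f where "f = chain_test m"
  define w where "w = path_eigvec (2 * m)"
  define D where "D = (\<lambda>u v. (f u - f v)\<^sup>2)"
  define U where "U = {(u, v). chain_up n t u v}"
  define c where "c = (\<lambda>u :: nat. D u (u + 1) + (if u mod 4 = 1 \<or> u mod 4 = 2 then D u (u + 2) else 0))"
  have finU: "finite U"
    by (rule finite_subset[of _ "{..<n} \<times> {..<n}"]) (auto simp: U_def chain_up_def)
  have arcs: "parcs (chain_graph n t) = U \<union> prod.swap ` U"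
    by (auto simp: chain_graph_def U_def image_iff)
  have "(\<Sum>(u, v)\<in>parcs (chain_graph n t). D u v) = (\<Sum>(u, v)\<in>U. D u v) + (\<Sum>(u, v)\<in>prod.swap ` U. D u v)"
    unfolding arcs using finU by (intro sum.union_disjoint) (auto simp: U_def chain_up_def)
  also have "(\<Sum>(u, v)\<in>prod.swap ` U. D u v) = (\<Sum>(u, v)\<in>U. D u v)"
    by (subst sum.reindex) (auto simp: D_def power2_commute case_prod_unfold intro!: sum.cong)
  finally have "dirichlet (chain_graph n t) f f = (\<Sum>(u, v)\<in>U. D u v)"
    by (simp add: dirichlet_def D_def power2_eq_square)
  also have "\<dots> = (\<Sum>(u, v)\<in>{(u, v) \<in> U. D u v \<noteq> 0}. D u v)"
    using finU by (intro sum.mono_neutral_right) auto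
  \<comment> \<open>Passing to the undisturbed periodic pattern may add pairs that are not edges,
    such as (2, 3), which only increases the sum.\<close>
  also have "\<dots> \<le> (\<Sum>(u, v)\<in>(\<lambda>u. (u, u + 1)) ` {..<n} \<union> (\<lambda>u. (u, u + 2)) ` {u. u < n \<and> (u mod 4 = 1 \<or> u mod 4 = 2)}. D u v)"
  proof (rule sum_mono2)
    have extra: "D u v = 0" if "u \<le> 5 \<and> v \<le> 5 \<or> 4 * m + 4 \<le> u \<and> 4 * m + 4 \<le> v" for u v
      using that m by (auto simp: D_def f_def chain_test_left chain_test_right)
    show "{(u, v) \<in> U. D u v \<noteq> 0} \<subseteq>
        (\<lambda>u. (u, u + 1)) ` {..<n} \<union> (\<lambda>u. (u, u + 2)) ` {u. u < n \<and> (u mod 4 = 1 \<or> u mod 4 = 2)}"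
    proof
      fix e assume "e \<in> {(u, v) \<in> U. D u v \<noteq> 0}"
      then obtain u v where e: "e = (u, v)" "chain_up n t u v" "D u v \<noteq> 0" by (auto simp: U_def)
      have "\<not> (u \<le> 5 \<and> v \<le> 5)" "\<not> (4 * m + 4 \<le> u \<and> 4 * m + 4 \<le> v)"
        using e(3) extra by blast+
      then have "u < n \<and> (v = u + 1 \<or> v = u + 2 \<and> (u mod 4 = 1 \<or> u mod 4 = 2))"
        using e(2) unfolding chain_up_def t by (elim conjE disjE) (simp_all split: if_splits)
      then show "e \<in> (\<lambda>u. (u, u + 1)) ` {..<n} \<union> (\<lambda>u. (u, u + 2)) ` {u. u < n \<and> (u mod 4 = 1 \<or> u mod 4 = 2)}"
        using e(1) by auto
    qed
  qed (auto simp: D_def)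
  also have "\<dots> = (\<Sum>u<n. D u (u + 1)) + (\<Sum>u | u < n \<and> (u mod 4 = 1 \<or> u mod 4 = 2). D u (u + 2))"
    by (subst sum.union_disjoint) (auto simp: sum.reindex inj_on_def)
  also have "(\<Sum>u | u < n \<and> (u mod 4 = 1 \<or> u mod 4 = 2). D u (u + 2)) =
      (\<Sum>u<n. if u mod 4 = 1 \<or> u mod 4 = 2 then D u (u + 2) else 0)"
    by (rule sum.mono_neutral_cong_left) auto
  also have "(\<Sum>u<n. D u (u + 1)) + \<dots> = (\<Sum>u<n. c u)"
    by (simp add: c_def sum.distrib)
  also have "\<dots> = (\<Sum>i<m. c (4 * i + 5) + c (4 * i + 6) + c (4 * i + 7) + c (4 * i + 8))"
  proof -
    have "c u = 0" if "u < 5" for u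
    proof -
      have "\<not> (u mod 4 = 1 \<or> u mod 4 = 2) \<or> u + 2 \<le> 5" using that by presburger
      then show ?thesis using that m by (auto simp: c_def D_def f_def chain_test_left)
    qed
    moreover have "c u = 0" if "4 * m + 5 \<le> u" for u
      using that m by (simp add: c_def D_def f_def chain_test_right)
    ultimately show ?thesis
      using t n by (subst sum_chain_split[of m]) auto
  qed
  also have "\<dots> = (\<Sum>i<m. (w (Suc (2 * i)) - w (2 * i))\<^sup>2 + (w (Suc (2 * i + 1)) - w (2 * i + 1))\<^sup>2)"
  proof (rule sum.cong)
    fix i assume "i \<in> {..<m}"
    then have i: "i < m" by simp
    have mods: "(4 * i + 5) mod 4 = 1" "(4 * i + 6) mod 4 = 2" "(4 * i + 7) mod 4 = 3" "(4 * i + 8) mod 4 = 0"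
      by presburger+
    have nums: "4 * i + 5 + 1 = 4 * i + 6" "4 * i + 5 + 2 = 4 * i + 7" "4 * i + 6 + 1 = 4 * i + 7"
      "4 * i + 6 + 2 = 4 * i + 8" "4 * i + 7 + 1 = 4 * i + 8" "4 * i + 8 + 1 = 4 * i + 9"
      by simp_all
    define a b where "a = w (2 * i)" and "b = w (2 * i + 1)"
    have fs: "f (4 * i + 5) = a" "f (4 * i + 6) = (a + b) / 2" "f (4 * i + 7) = (a + b) / 2" "f (4 * i + 8) = b"
      "f (4 * i + 9) = w (2 * i + 2)"
      using chain_test_block[OF i] chain_test_next[OF i] by (simp_all add: f_def w_def a_def b_def)
    have cs: "c (4 * i + 5) = (a - (a + b) / 2)\<^sup>2 + (a - (a + b) / 2)\<^sup>2" "c (4 * i + 6) = ((a + b) / 2 - b)\<^sup>2"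
      "c (4 * i + 7) = ((a + b) / 2 - b)\<^sup>2" "c (4 * i + 8) = (b - w (2 * i + 2))\<^sup>2"
      unfolding c_def D_def mods nums fs by simp_all
    have "c (4 * i + 5) + c (4 * i + 6) + c (4 * i + 7) + c (4 * i + 8) = (b - a)\<^sup>2 + (w (2 * i + 2) - b)\<^sup>2"
      unfolding cs by (simp add: power2_eq_square field_simps)
    then show "c (4 * i + 5) + c (4 * i + 6) + c (4 * i + 7) + c (4 * i + 8) =
        (w (Suc (2 * i)) - w (2 * i))\<^sup>2 + (w (Suc (2 * i + 1)) - w (2 * i + 1))\<^sup>2"
      by (simp add: a_def b_def)
  qed simp
  also have "\<dots> = (\<Sum>j<2 * m. (w (Suc j) - w j)\<^sup>2)"
    by (rule sum_pairs)
  finally show ?thesis by (simp add: f_def w_def)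
qed

text \<open>A block contributes \<open>2 * (w (2 * i) + w (2 * i + 1))\<close>, and these cancel
  because the eigenvector has mean zero. There remain 5 vertices on the left and at most 7 on the
  right, with values of modulus at most 1.\<close>

lemma chain_test_sum:
  assumes m: "m \<ge> 1" and n: "4 * m + 5 \<le> n" "n \<le> 4 * m + 12"
  shows "\<bar>\<Sum>v<n. chain_test m v\<bar> \<le> 12"
proof -
  define w where "w = path_eigvec (2 * m)"
  have "(\<Sum>v<n. chain_test m v) = 5 * w 0 + (\<Sum>i<m. 2 * (w (2 * i) + w (2 * i + 1))) + (n - (4 * m + 5)) * w (2 * m)"
  proof -
    have "chain_test m (4 * i + 5) + chain_test m (4 * i + 6) + chain_test m (4 * i + 7) + chain_test m (4 * i + 8)
        = 2 * (w (2 * i) + w (2 * i + 1))" if "i < m" for i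
      by (simp only: chain_test_block[OF that] w_def) (simp add: field_simps)
    then show ?thesis
      unfolding sum_chain_split[OF n(1)] using m by (simp add: chain_test_left chain_test_right w_def)
  qed
  also have "(\<Sum>i<m. 2 * (w (2 * i) + w (2 * i + 1))) = 0"
    unfolding sum_distrib_left[symmetric] sum_pairs w_def using sum_path_eigvec[of "2 * m"] m by simp
  finally have "\<bar>\<Sum>v<n. chain_test m v\<bar> \<le> 5 * \<bar>w 0\<bar> + (n - (4 * m + 5)) * \<bar>w (2 * m)\<bar>"
    by (auto simp: abs_mult intro: order_trans[OF abs_triangle_ineq])
  also have "\<dots> \<le> 5 * 1 + 7 * 1"
    using n abs_path_eigvec_le by (intro add_mono mult_mono) (auto simp: w_def)
  finally show ?thesis by simp
qed

text \<open>Averaging inside a block costs (b - a)^2 / 2 against 2 (a^2 + b^2), and the squares of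
  the eigenvector sum to \<open>m\<close>; the end vertices are dropped.\<close>

lemma chain_test_sum_sq:
  assumes m: "m \<ge> 1" and n: "4 * m + 5 \<le> n"
  shows "2 * m - (\<Sum>j<2 * m. (path_eigvec (2 * m) (Suc j) - path_eigvec (2 * m) j)\<^sup>2) / 2
    \<le> (\<Sum>v<n. (chain_test m v)\<^sup>2)"
proof -
  define w where "w = path_eigvec (2 * m)"
  define d where "d = (\<lambda>j. (w (Suc j) - w j)\<^sup>2)"
  have "2 * m - (\<Sum>j<2 * m. d j) / 2 = 2 * (\<Sum>j<2 * m. (w j)\<^sup>2) - (\<Sum>j<2 * m. d j) / 2"
    using sum_path_eigvec_sq[of "2 * m"] m by (simp add: w_def)
  also have "\<dots> = (\<Sum>i<m. 2 * ((w (2 * i))\<^sup>2 + (w (2 * i + 1))\<^sup>2) - (d (2 * i) + d (2 * i + 1)) / 2)"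
    unfolding sum_subtractf sum_divide_distrib[symmetric] sum_distrib_left[symmetric] sum_pairs
      sum_pairs[of "\<lambda>j. (w j)\<^sup>2"] ..
  also have "\<dots> \<le> (\<Sum>i<m. (chain_test m (4 * i + 5))\<^sup>2 + (chain_test m (4 * i + 6))\<^sup>2
      + (chain_test m (4 * i + 7))\<^sup>2 + (chain_test m (4 * i + 8))\<^sup>2)"
  proof (rule sum_mono)
    fix i assume "i \<in> {..<m}"
    then have i: "i < m" by simp
    define a b where "a = w (2 * i)" and "b = w (2 * i + 1)"
    have eq: "2 * (a\<^sup>2 + b\<^sup>2) - (b - a)\<^sup>2 / 2 = a\<^sup>2 + ((a + b) / 2)\<^sup>2 + ((a + b) / 2)\<^sup>2 + b\<^sup>2"
      by (simp add: power2_eq_square field_simps)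
    have d: "d (2 * i) = (b - a)\<^sup>2" "d (2 * i + 1) \<ge> 0" by (simp_all add: d_def a_def b_def)
    show "2 * ((w (2 * i))\<^sup>2 + (w (2 * i + 1))\<^sup>2) - (d (2 * i) + d (2 * i + 1)) / 2
      \<le> (chain_test m (4 * i + 5))\<^sup>2 + (chain_test m (4 * i + 6))\<^sup>2
      + (chain_test m (4 * i + 7))\<^sup>2 + (chain_test m (4 * i + 8))\<^sup>2"
      unfolding chain_test_block[OF i] w_def[symmetric] a_def[symmetric] b_def[symmetric] eq[symmetric] d(1)
      using d(2) by (simp only: add_divide_distrib)
  qed
  also have "\<dots> \<le> (\<Sum>v<n. (chain_test m v)\<^sup>2)"
    unfolding sum_chain_split[OF n] by (simp add: sum_nonneg)
  finally show ?thesis by (simp add: d_def w_def)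
qed

text \<open>Centring the test function leaves its energy unchanged and lowers its squared norm by at
  most 12^2 / n.\<close>

lemma algebraic_connectivity_chain:
  fixes m t n :: nat
  assumes m: "m \<ge> 1" and t: "t = 4 * m + 6" and n: "n = t + 4 \<or> n = t + 6"
  shows "algebraic_connectivity (chain_graph n t) * (2 * m - pi\<^sup>2 / (8 * m) - 144 / n) \<le> pi\<^sup>2 / (4 * m)"
proof -
  have "t mod 4 = 2" using t by presburger
  then have cubic: "chain_graph n t \<in> connected_cubic_graphs n"
    using n t by (intro chain_graph_cubic) auto
  then interpret connected_graph_on "chain_graph n t" n
    by (rule connected_graph_on_cubic)
  define f where "f = chain_test m"
  define E where "E = (\<Sum>j<2 * m. (path_eigvec (2 * m) (Suc j) - path_eigvec (2 * m) j)\<^sup>2)"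
  define \<mu> where "\<mu> = algebraic_connectivity (chain_graph n t)"
  define s where "s = (\<Sum>v<n. f v) / n"
  define g where "g = (\<lambda>v. f v - s)"
  have n': "4 * m + 5 \<le> n" "n \<le> 4 * m + 12" "n \<ge> 2" using n t by auto
  have ns: "(\<Sum>v<n. f v) = n * s" using n' by (simp add: s_def)
  have mean: "(\<Sum>v<n. g v) = 0" using n' by (simp add: g_def s_def sum_subtractf)
  have E: "E \<le> pi\<^sup>2 / (4 * m)" using path_eigvec_energy[of "2 * m"] m by (simp add: E_def)
  have Dg: "dirichlet (chain_graph n t) g g \<le> E"
    using chain_energy[OF assms] by (simp add: g_def dirichlet_def E_def f_def)
  have "(\<Sum>v<n. (g v)\<^sup>2) = (\<Sum>v<n. (f v)\<^sup>2 + (s\<^sup>2 - 2 * s * f v))"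
    by (rule sum.cong) (simp_all add: g_def power2_eq_square algebra_simps)
  also have "\<dots> = (\<Sum>v<n. (f v)\<^sup>2) + (n * s\<^sup>2 - 2 * s * (n * s))"
    unfolding sum.distrib sum_subtractf sum_distrib_left[symmetric] ns by simp
  also have "\<dots> = (\<Sum>v<n. (f v)\<^sup>2) - (n * s)\<^sup>2 / n"
    using n' by (simp add: power2_eq_square)
  finally have g2: "(\<Sum>v<n. (g v)\<^sup>2) = (\<Sum>v<n. (f v)\<^sup>2) - (\<Sum>v<n. f v)\<^sup>2 / n"
    using n' by (simp add: s_def)
  have "(\<Sum>v<n. f v)\<^sup>2 \<le> 12\<^sup>2"
    using chain_test_sum[OF m n'(1,2)] by (subst abs_le_square_iff[symmetric]) (simp add: f_def)
  then have "(\<Sum>v<n. f v)\<^sup>2 / n \<le> 144 / n" by (intro divide_right_mono) auto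
  moreover have "2 * m - E / 2 \<le> (\<Sum>v<n. (f v)\<^sup>2)"
    using chain_test_sum_sq[OF m n'(1)] by (simp add: f_def E_def)
  moreover have "E / 2 \<le> pi\<^sup>2 / (8 * m)" using E by simp
  ultimately have low: "2 * m - pi\<^sup>2 / (8 * m) - 144 / n \<le> (\<Sum>v<n. (g v)\<^sup>2)"
    unfolding g2 by linarith
  have "\<mu> * (2 * m - pi\<^sup>2 / (8 * m) - 144 / n) \<le> \<mu> * (\<Sum>v<n. (g v)\<^sup>2)"
    using low algebraic_connectivity_nonneg[OF n'(3)] unfolding \<mu>_def by (rule mult_left_mono)
  also have "\<dots> \<le> dirichlet (chain_graph n t) g g"
    unfolding \<mu>_def by (rule algebraic_connectivity_le[OF n'(3) mean])
  also have "\<dots> \<le> pi\<^sup>2 / (4 * m)" using Dg E by simp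
  finally show ?thesis by (simp add: \<mu>_def)
qed

section \<open>Asymptotics of the minimum\<close>

text \<open>For an eigenfunction renamed by rank (\<open>\<sigma>\<close> maps ranks to vertices)
  the energy is \<open>\<mu> * X\<close>, so \<open>energy_lower_bound\<close> reads
  \<open>sqrt X \<le> sqrt (\<mu> * X) * K\<close> and \<open>X\<close> cancels.\<close>

lemma cubic_algebraic_connectivity_ge:
  assumes G: "G \<in> connected_cubic_graphs n" and n2: "n \<ge> 2"
  shows "1 / (1 / sqrt (2 * (2 - 2 * cos (pi / n))) + 8)\<^sup>2 \<le> algebraic_connectivity G"
proof -
  interpret connected_graph_on G n using G by (rule connected_graph_on_cubic)
  obtain f where f: "(\<Sum>i<n. f i) = 0" "(\<Sum>i<n. (f i)\<^sup>2) > 0"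
    "dirichlet G f f = algebraic_connectivity G * (\<Sum>i<n. (f i)\<^sup>2)"
    using algebraic_connectivity_attained[OF n2] by metis
  define xs where "xs = sort_key f [0..<n]"
  define \<sigma> where "\<sigma> = (\<lambda>i. xs ! i)"
  have xs: "length xs = n" "distinct xs" "set xs = {..<n}" "sorted (map f xs)"
    by (auto simp: xs_def)
  have bij: "bij_betw \<sigma> {..<n} {..<n}"
    unfolding \<sigma>_def using xs by (intro bij_betw_nth) auto
  have inj: "inj_on \<sigma> {..<n}" and img: "\<sigma> ` {..<n} = {..<n}"
    using bij by (auto simp: bij_betw_def)
  have \<sigma>_less: "\<sigma> i < n" if "i < n" for i using img that by blast
  have \<sigma>_surj: "\<exists>i<n. \<sigma> i = v" if "v < n" for v
  proof -
    have "v \<in> \<sigma> ` {..<n}" using that unfolding img by simp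
    then show ?thesis by auto
  qed
  define R where "R = {(i, j). i < n \<and> j < n \<and> (\<sigma> i, \<sigma> j) \<in> parcs G}"
  interpret S: sorted_cubic R n "\<lambda>i. f (\<sigma> i)"
  proof
    show "R \<subseteq> {..<n} \<times> {..<n}" by (auto simp: R_def)
    show "(j, i) \<in> R" if "(i, j) \<in> R" for i j
      using that arcs_sym by (auto simp: R_def)
    show "(i, i) \<notin> R" for i using no_loop by (auto simp: R_def)
    show "card {j. (i, j) \<in> R} = 3" if i: "i < n" for i
    proof -
      have "{v. (\<sigma> i, v) \<in> parcs G} = \<sigma> ` {j. (i, j) \<in> R}"
      proof
        show "{v. (\<sigma> i, v) \<in> parcs G} \<subseteq> \<sigma> ` {j. (i, j) \<in> R}"
        proof
          fix v assume v: "v \<in> {v. (\<sigma> i, v) \<in> parcs G}"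
          then obtain j where "j < n" "\<sigma> j = v" using arcs_less \<sigma>_surj by blast
          then show "v \<in> \<sigma> ` {j. (i, j) \<in> R}" using v i by (auto simp: R_def)
        qed
      qed (auto simp: R_def)
      moreover have "inj_on \<sigma> {j. (i, j) \<in> R}"
        by (rule inj_on_subset[OF inj]) (auto simp: R_def)
      ultimately have "card {j. (i, j) \<in> R} = card {v. (\<sigma> i, v) \<in> parcs G}"
        by (simp add: card_image)
      also have "\<dots> = 3"
        using G \<sigma>_less[OF i] by (simp add: connected_cubic_graphs_def out_degree_with_proj)
      finally show ?thesis .
    qed
    show "\<exists>i j. (i, j) \<in> R \<and> i < k \<and> k \<le> j" if k: "0 < k" "k < n" for k
    proof (rule ccontr)
      \<comment> \<open>The vertices of rank below \<open>k\<close> would then be closed under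
        adjacency and include the one of rank \<open>k\<close>.\<close>
      assume no: "\<nexists>i j. (i, j) \<in> R \<and> i < k \<and> k \<le> j"
      have "\<sigma> k \<in> \<sigma> ` {..<k}"
      proof (rule closed_set_all)
        show "\<sigma> 0 \<in> \<sigma> ` {..<k}" using k by auto
        show "\<sigma> 0 < n" "\<sigma> k < n" using k by (auto intro: \<sigma>_less)
        fix x y assume x: "x \<in> \<sigma> ` {..<k}" and xy: "(x, y) \<in> parcs G"
        then obtain i where i: "i < k" "x = \<sigma> i" by auto
        obtain j where j: "j < n" "\<sigma> j = y" using xy arcs_less \<sigma>_surj by blast
        have "(i, j) \<in> R" using i j xy k by (auto simp: R_def)
        then have "j < k" using no i by force
        then show "y \<in> \<sigma> ` {..<k}" using j by auto
      qed
      then obtain i where "i < k" "\<sigma> i = \<sigma> k" by auto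
      then show False using inj k by (auto dest: inj_onD)
    qed
    show "f (\<sigma> i) \<le> f (\<sigma> j)" if "i \<le> j" "j < n" for i j
      using sorted_nth_mono[OF xs(4), of i j] that xs(1) by (simp add: \<sigma>_def)
  qed
  have sum0: "(\<Sum>i<n. f (\<sigma> i)) = 0" and sum2: "(\<Sum>i<n. (f (\<sigma> i))\<^sup>2) = (\<Sum>i<n. (f i)\<^sup>2)"
    using f(1) sum.reindex_bij_betw[OF bij, of f] sum.reindex_bij_betw[OF bij, of "\<lambda>i. (f i)\<^sup>2"] by auto
  define D where "D = (\<lambda>e :: nat \<times> nat. (f (\<sigma> (snd e)) - f (\<sigma> (fst e)))\<^sup>2)"
  have arcs: "parcs G = map_prod \<sigma> \<sigma> ` R"
  proof
    show "parcs G \<subseteq> map_prod \<sigma> \<sigma> ` R"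
    proof
      fix e assume e: "e \<in> parcs G"
      obtain u v where uv: "e = (u, v)" by force
      obtain i j where "i < n" "\<sigma> i = u" "j < n" "\<sigma> j = v"
        using e uv arcs_less \<sigma>_surj by metis
      then show "e \<in> map_prod \<sigma> \<sigma> ` R" using e uv by (force simp: R_def)
    qed
  qed (auto simp: R_def)
  have "inj_on (map_prod \<sigma> \<sigma>) R"
    by (rule inj_on_subset[OF map_prod_inj_on[OF inj inj] S.R_sub])
  then have "(\<Sum>(u, v)\<in>parcs G. (f u - f v) * (f u - f v)) = (\<Sum>e\<in>R. D e)"
    unfolding arcs
    by (subst sum.reindex) (auto simp: D_def case_prod_unfold power2_eq_square algebra_simps intro!: sum.cong)
  also have "R = S.edges \<union> prod.swap ` S.edges"
    using S.R_sym S.R_irrefl by (auto simp: S.edges_def image_iff) (metis linorder_neqE_nat)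
  also have "(\<Sum>e\<in>\<dots>. D e) = (\<Sum>e\<in>S.edges. D e) + (\<Sum>e\<in>prod.swap ` S.edges. D e)"
    by (rule sum.union_disjoint[OF S.finite_edges finite_imageI[OF S.finite_edges]])
      (auto simp: S.edges_def)
  also have "(\<Sum>e\<in>prod.swap ` S.edges. D e) = (\<Sum>e\<in>S.edges. D e)"
    by (subst sum.reindex) (auto simp: D_def power2_commute intro!: sum.cong)
  finally have energy: "dirichlet G f f = (\<Sum>(i, j)\<in>S.edges. (f (\<sigma> j) - f (\<sigma> i))\<^sup>2)"
    by (simp add: dirichlet_def D_def case_prod_unfold)
  define X \<mu> K where "X = (\<Sum>i<n. (f i)\<^sup>2)" and "\<mu> = algebraic_connectivity G"
    and "K = 1 / sqrt (2 * (2 - 2 * cos (pi / n))) + 8"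
  have "cos (pi / n) \<le> 1" by simp
  then have K: "K > 0" unfolding K_def by (intro add_nonneg_pos) auto
  have X: "X > 0" using f by (simp add: X_def)
  have "sqrt X \<le> sqrt (\<mu> * X) * K"
    using S.energy_lower_bound[OF n2 sum0] f(3) by (simp add: sum2 X_def \<mu>_def K_def flip: energy)
  then have "sqrt X * 1 \<le> sqrt X * (sqrt \<mu> * K)"
    by (simp add: real_sqrt_mult mult_ac)
  then have "1 \<le> sqrt \<mu> * K"
    using X by (subst (asm) mult_le_cancel_left_pos) auto
  then have "1\<^sup>2 \<le> (sqrt \<mu> * K)\<^sup>2"
    by (rule power_mono) simp
  also have "\<dots> = \<mu> * K\<^sup>2"
    using algebraic_connectivity_nonneg[OF n2] by (simp add: power_mult_distrib \<mu>_def)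
  finally show ?thesis
    using K by (simp add: \<mu>_def K_def field_simps)
qed

text \<open>\<open>n\<close> is \<open>4 * m + 10\<close> or \<open>4 * m + 12\<close> for a chain
  of \<open>m\<close> blocks, so \<open>M \<le> m\<close>. The bound is monotone in
  \<open>m\<close>, and with \<open>M\<close> it becomes one explicit function of \<open>n\<close>
  for both residues.\<close>

lemma mu_min_upper:
  fixes M :: real
  assumes n: "even n" "n \<ge> 14" and M: "M = (real n - 12) / 4"
    and pos: "2 * M - pi\<^sup>2 / (8 * M) - 144 / n > 0"
  shows "connected_cubic_graphs n \<noteq> {}"
    and "mu_min n \<le> pi\<^sup>2 / (4 * M) / (2 * M - pi\<^sup>2 / (8 * M) - 144 / n)"
proof -
  define m where "m = (n - 10) div 4"
  define t where "t = 4 * m + 6"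
  have m: "m \<ge> 1" using n by (simp add: m_def)
  have nt: "n = t + 4 \<or> n = t + 6" using n unfolding t_def m_def by presburger
  have "t mod 4 = 2" unfolding t_def by presburger
  then have cubic: "chain_graph n t \<in> connected_cubic_graphs n"
    using nt by (intro chain_graph_cubic) (auto simp: t_def)
  then show "connected_cubic_graphs n \<noteq> {}" by blast
  interpret connected_graph_on "chain_graph n t" n using cubic by (rule connected_graph_on_cubic)
  define \<mu> where "\<mu> = algebraic_connectivity (chain_graph n t)"
  have \<mu>: "\<mu> \<ge> 0" unfolding \<mu>_def using n by (intro algebraic_connectivity_nonneg) auto
  have M0: "M > 0" using n by (simp add: M)
  have Mm: "M \<le> m" using nt by (auto simp: M t_def)
  have "\<mu> * (2 * M - pi\<^sup>2 / (8 * M) - 144 / n) \<le> \<mu> * (2 * m - pi\<^sup>2 / (8 * m) - 144 / n)"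
  proof (rule mult_left_mono[OF _ \<mu>])
    have "pi\<^sup>2 / (8 * m) \<le> pi\<^sup>2 / (8 * M)"
      using M0 Mm by (intro divide_left_mono) auto
    then show "2 * M - pi\<^sup>2 / (8 * M) - 144 / n \<le> 2 * m - pi\<^sup>2 / (8 * m) - 144 / n"
      using Mm by linarith
  qed
  also have "\<dots> \<le> pi\<^sup>2 / (4 * m)"
    unfolding \<mu>_def by (rule algebraic_connectivity_chain[OF m t_def nt])
  also have "\<dots> \<le> pi\<^sup>2 / (4 * M)"
    using M0 Mm by (intro divide_left_mono) auto
  finally have "\<mu> \<le> pi\<^sup>2 / (4 * M) / (2 * M - pi\<^sup>2 / (8 * M) - 144 / n)"
    by (rule pos_le_divide_eq[OF pos, THEN iffD2])
  moreover have "mu_min n \<le> \<mu>"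
    unfolding mu_min_def \<mu>_def using cubic finite_connected_cubic_graphs by (intro Min_le) auto
  ultimately show "mu_min n \<le> pi\<^sup>2 / (4 * M) / (2 * M - pi\<^sup>2 / (8 * M) - 144 / n)" by simp
qed

lemma asymp_equiv_filter_mono: "f \<sim>[F] g \<Longrightarrow> F' \<le> F \<Longrightarrow> f \<sim>[F'] g"
  unfolding asymp_equiv_def by (rule tendsto_mono)

text \<open>After scaling by n^2 the additive 8 becomes 8 / n and disappears in the limit.\<close>

lemma poincare_bound_asymp:
  "(\<lambda>n :: nat. 1 / (1 / sqrt (2 * (2 - 2 * cos (pi / n))) + 8)\<^sup>2) \<sim>[at_top] (\<lambda>n. 2 * pi\<^sup>2 / (real n)\<^sup>2)"
proof -
  have "(\<lambda>n :: nat. (2 - 2 * cos (pi / n)) * (real n)\<^sup>2) \<longlonglongrightarrow> pi\<^sup>2"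
    unfolding power2_eq_square by real_asymp
  then have "(\<lambda>n :: nat. 1 / (1 / sqrt (2 * ((2 - 2 * cos (pi / n)) * (real n)\<^sup>2)) + 8 / n)\<^sup>2)
      \<longlonglongrightarrow> 1 / (1 / sqrt (2 * pi\<^sup>2) + 0)\<^sup>2"
    by (intro tendsto_intros lim_const_over_n) auto
  moreover have "1 / (1 / sqrt (2 * pi\<^sup>2) + 0)\<^sup>2 = 2 * pi\<^sup>2"
    by (simp add: power_divide)
  moreover have "\<forall>\<^sub>F n in at_top. 1 / (1 / sqrt (2 * ((2 - 2 * cos (pi / n)) * (real n)\<^sup>2)) + 8 / n)\<^sup>2 =
      1 / (1 / sqrt (2 * (2 - 2 * cos (pi / n))) + 8)\<^sup>2 / (1 / (real n)\<^sup>2)"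
    using eventually_gt_at_top[of 0]
  proof eventually_elim
    case (elim n)
    define x where "x = 2 * (2 - 2 * cos (pi / n))"
    have "2 * ((2 - 2 * cos (pi / n)) * (real n)\<^sup>2) = x * (real n)\<^sup>2"
      by (simp add: x_def)
    then have "1 / sqrt (2 * ((2 - 2 * cos (pi / n)) * (real n)\<^sup>2)) + 8 / n = (1 / sqrt x + 8) / n"
      using elim by (simp only: real_sqrt_mult) (simp add: add_divide_distrib)
    then show ?case
      unfolding x_def[symmetric] by (simp only: power_divide) simp
  qed
  ultimately have "(\<lambda>n :: nat. 1 / (1 / sqrt (2 * (2 - 2 * cos (pi / n))) + 8)\<^sup>2 / (1 / (real n)\<^sup>2)) \<longlonglongrightarrow> 2 * pi\<^sup>2"
    using tendsto_cong by force
  from asymp_equivI'_const[OF this] show ?thesis by simp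
qed
lemma chain_bound_asymp:
  "(\<lambda>n :: nat. pi\<^sup>2 / (4 * ((real n - 12) / 4)) / 
    (2 * ((real n - 12) / 4) - pi\<^sup>2 / (8 * ((real n - 12) / 4)) - 144 / n)) \<sim>[at_top] (\<lambda>n. 2 * pi\<^sup>2 / (real n)\<^sup>2)"
proof -
  have "(\<lambda>n :: nat. pi\<^sup>2 / (4 * ((real n - 12) / 4)) /
    (2 * ((real n - 12) / 4) - pi\<^sup>2 / (8 * ((real n - 12) / 4)) - 144 / n) / (1 / (real n)\<^sup>2)) \<longlonglongrightarrow> 2 * pi\<^sup>2"
    by real_asymp
  from asymp_equivI'_const[OF this] show ?thesis by simp
qed
theorem theorem2p2:
  shows "mu_min \<sim>[inf at_top (principal {n. even n \<and> 4 \<le> n})] (\<lambda>n. 2 * pi\<^sup>2 / (real n)\<^sup>2)"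
proof -
  define F :: "nat filter" where "F = inf at_top (principal {n. even n \<and> 4 \<le> n})"
  define l where "l = (\<lambda>n :: nat. 1 / (1 / sqrt (2 * (2 - 2 * cos (pi / n))) + 8)\<^sup>2)"
  define den where "den = (\<lambda>n :: nat. 2 * ((real n - 12) / 4) - pi\<^sup>2 / (8 * ((real n - 12) / 4)) - 144 / n)"
  define u where "u = (\<lambda>n :: nat. pi\<^sup>2 / (4 * ((real n - 12) / 4)) / den n)"
  have "F \<le> at_top" by (simp add: F_def)
  note filter_mono = asymp_equiv_filter_mono[OF _ this]
  have l: "l \<sim>[F] (\<lambda>n. 2 * pi\<^sup>2 / (real n)\<^sup>2)"
    unfolding l_def by (rule filter_mono[OF poincare_bound_asymp])
  have u: "u \<sim>[F] (\<lambda>n. 2 * pi\<^sup>2 / (real n)\<^sup>2)"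
    unfolding u_def den_def by (rule filter_mono[OF chain_bound_asymp])
  have "\<forall>\<^sub>F n in F. mu_min n \<in> {l n..u n}"
  proof -
    have "\<forall>\<^sub>F n in at_top. den n > 0" unfolding den_def by real_asymp
    then have "\<forall>\<^sub>F n in at_top. den n > 0 \<and> n \<ge> 14"
      using eventually_ge_at_top[of "14 :: nat"] by eventually_elim auto
    then show ?thesis
      unfolding F_def eventually_inf_principal
    proof eventually_elim
      case (elim n)
      show ?case
      proof
        assume "n \<in> {n. even n \<and> 4 \<le> n}"
        then have n: "even n" by simp
        have pos: "2 * ((real n - 12) / 4) - pi\<^sup>2 / (8 * ((real n - 12) / 4)) - 144 / n > 0"
          using elim by (simp only: den_def)
        \<comment> \<open>\<open>Min\<close> of an empty set is unspecified, so the lower bound on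
          \<open>mu_min\<close> also depends on the chain graph existing.\<close>
        have ne: "connected_cubic_graphs n \<noteq> {}"
          using mu_min_upper(1)[OF n _ refl pos] elim by blast
        have "mu_min n \<le> u n"
          using mu_min_upper(2)[OF n _ refl pos] elim unfolding u_def den_def by blast
        moreover have "l n \<le> algebraic_connectivity G" if "G \<in> connected_cubic_graphs n" for G
          unfolding l_def using that elim by (intro cubic_algebraic_connectivity_ge) auto
        then have "l n \<le> mu_min n"
          unfolding mu_min_def using ne finite_connected_cubic_graphs by (subst Min_ge_iff) auto
        ultimately show "mu_min n \<in> {l n..u n}" by simp
      qed
    qed
  qed
  then show ?thesis
    unfolding F_def[symmetric] by (rule asymp_equiv_sandwich_real[OF l u])
qed

end
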